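(* Let $\phi\in Aut(\mathbb{Z}^n)$ be such that $\phi$ is diagonalizable over $\mathbb{R}$ (so that all of its eigenvalues are real), and let $\mathbb{Z}$ act on $\mathbb{Z}^n$ via $\phi$. Then every subgroup of $P_{n,\phi}=\mathbb{Z}^n\rtimes_\phi\mathbb{Z}$ has bounded packing in $P_{n,\phi}$.
   Context: $Aut(\mathbb{Z}^n)$ is identified with $GL_n(\mathbb{Z})\subseteq GL_n(\mathbb{R})$. $\mathbb{Z}^n\rtimes_\phi\mathbb{Z}=\langle \mathbb{Z}^n,t : tat^{-1}=\phi(a),\ a\in\mathbb{Z}^n\rangle$. The action of $\mathbb{Z}$ on $\mathbb{Z}^n$ given by $1\mapsto\phi$ is called diagonal if $\phi$ is diagonalizable over $\mathbb{R}$. Bounded packing: let $G$ be a finitely generated group with a word metric $d$ (for a finite generating set), and put $d(S,T)=\inf\{d(s,t):s\in S,t\in T\}$ for $S,T\subseteq G$. A subgroup $H\le G$ has bounded packing in $G$ if for every $r>0$ there is a number $N$ (depending on $G,H,r$) such that any collection of $N$ distinct left cosets $g_1H,\dots,g_NH$ contains a pair $g_iH,g_jH$ with $d(g_iH,g_jH)\ge r$. (The property does not depend on the choice of finite generating set.) *)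

theory Defs
  imports
    "Jordan_Normal_Form.Matrix"
    "HOL-Algebra.Bij"
    "HOL-Algebra.Left_Coset"
    "HOL-Algebra.Generated_Groups"
    "HOL-Algebra.Elementary_Groups"
begin

section \<open>Semidirect products\<close>

definition semidirect_product ::
  "('a, 'c) monoid_scheme \<Rightarrow> ('b, 'd) monoid_scheme \<Rightarrow> ('b \<Rightarrow> 'a \<Rightarrow> 'a) \<Rightarrow> ('a \<times> 'b) monoid"
  where "semidirect_product N Q \<alpha> =
    \<lparr>carrier = carrier N \<times> carrier Q,
     monoid.mult = (\<lambda>(a, p) (b, q). (a \<otimes>\<^bsub>N\<^esub> \<alpha> p b, p \<otimes>\<^bsub>Q\<^esub> q)),
     one = (\<one>\<^bsub>N\<^esub>, \<one>\<^bsub>Q\<^esub>)\<rparr>"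

lemma (in group) group_semidirect_product:
  assumes "group Q" and \<alpha>: "\<alpha> \<in> hom Q (AutoGroup G)"
  shows "group (semidirect_product G Q \<alpha>)"
proof -
  interpret Q: group Q by fact
  interpret h: group_hom Q "AutoGroup G" \<alpha>
    using \<alpha> \<open>group Q\<close> AutoGroup by (simp add: group_hom_def group_hom_axioms_def)
  have aut: "\<alpha> p \<in> auto G" if "p \<in> carrier Q" for p
    using h.hom_closed[OF that] by (simp add: AutoGroup_def)
  have closed: "\<alpha> p a \<in> carrier G" if "p \<in> carrier Q" "a \<in> carrier G" for p a
    using aut[OF that(1)] that(2) by (auto simp: auto_def hom_def)
  have mult: "\<alpha> p (a \<otimes> b) = \<alpha> p a \<otimes> \<alpha> p b"
    if "p \<in> carrier Q" "a \<in> carrier G" "b \<in> carrier G" for p a b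
    using aut[OF that(1)] that(2,3) by (auto simp: auto_def hom_def)
  have comp: "\<alpha> (p \<otimes>\<^bsub>Q\<^esub> q) a = \<alpha> p (\<alpha> q a)"
    if "p \<in> carrier Q" "q \<in> carrier Q" "a \<in> carrier G" for p q a
    using h.hom_mult[OF that(1,2)] aut[OF that(1)] aut[OF that(2)] that(3)
    by (simp add: AutoGroup_def BijGroup_def auto_def compose_def)
  have id: "\<alpha> \<one>\<^bsub>Q\<^esub> a = a" if "a \<in> carrier G" for a
    using h.hom_one that by (simp add: AutoGroup_def BijGroup_def)
  show ?thesis
  proof (rule groupI)
    fix x assume "x \<in> carrier (semidirect_product G Q \<alpha>)"
    then obtain a p where x: "x = (a, p)" "a \<in> carrier G" "p \<in> carrier Q"
      by (auto simp: semidirect_product_def)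
    define q where "q = inv\<^bsub>Q\<^esub> p"
    have q: "q \<in> carrier Q" "q \<otimes>\<^bsub>Q\<^esub> p = \<one>\<^bsub>Q\<^esub>"
      using x by (simp_all add: q_def)
    have "\<alpha> q (inv a) \<otimes> \<alpha> q a = \<alpha> q \<one>"
      using x q mult[of q "inv a" a] by simp
    moreover have "\<alpha> q \<one> = \<one>"
      using q mult[of q \<one> \<one>] closed[of q \<one>] by simp
    ultimately show "\<exists>y\<in>carrier (semidirect_product G Q \<alpha>).
        y \<otimes>\<^bsub>semidirect_product G Q \<alpha>\<^esub> x = \<one>\<^bsub>semidirect_product G Q \<alpha>\<^esub>"
      using x q closed
      by (intro bexI[of _ "(\<alpha> q (inv a), q)"]) (auto simp: semidirect_product_def)
  qed (auto simp: semidirect_product_def closed mult comp id m_assoc Q.m_assoc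
      simp del: h.hom_mult h.hom_one)
qed


section \<open>Word metrics and bounded packing\<close>

definition finite_generating_set :: "('a, 'b) monoid_scheme \<Rightarrow> 'a set \<Rightarrow> bool"
  where "finite_generating_set G S \<longleftrightarrow>
    finite S \<and> S \<subseteq> carrier G \<and> generate G S = carrier G"

definition word_length :: "('a, 'b) monoid_scheme \<Rightarrow> 'a set \<Rightarrow> 'a \<Rightarrow> nat"
  where "word_length G S g =
    (LEAST k. \<exists>w. length w = k \<and> set w \<subseteq> S \<union> m_inv G ` S \<and>
      foldr (\<lambda>x y. x \<otimes>\<^bsub>G\<^esub> y) w \<one>\<^bsub>G\<^esub> = g)"

definition word_dist :: "('a, 'b) monoid_scheme \<Rightarrow> 'a set \<Rightarrow> 'a \<Rightarrow> 'a \<Rightarrow> nat"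
  where "word_dist G S g h = word_length G S (inv\<^bsub>G\<^esub> g \<otimes>\<^bsub>G\<^esub> h)"

text \<open>The infimum is taken in \<^typ>\<open>nat\<close>, where it is a minimum; it has its usual
  meaning for nonempty \<open>A\<close> and \<open>B\<close>, such as cosets.\<close>

definition word_set_dist :: "('a, 'b) monoid_scheme \<Rightarrow> 'a set \<Rightarrow> 'a set \<Rightarrow> 'a set \<Rightarrow> nat"
  where "word_set_dist G S A B = Inf {word_dist G S a b | a b. a \<in> A \<and> b \<in> B}"

definition bounded_packing_wrt :: "('a, 'b) monoid_scheme \<Rightarrow> 'a set \<Rightarrow> 'a set \<Rightarrow> bool"
  where "bounded_packing_wrt G S H \<longleftrightarrow>
    (\<forall>r::real. r > 0 \<longrightarrow> (\<exists>N::nat. \<forall>C. C \<subseteq> lcosets\<^bsub>G\<^esub> H \<and> finite C \<and> card C = N \<longrightarrow>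
      (\<exists>A\<in>C. \<exists>B\<in>C. A \<noteq> B \<and> real (word_set_dist G S A B) \<ge> r)))"

text \<open>Bounded packing does not depend on the finite generating set, so we may quantify over
  all of them; the first conjunct demands that \<open>G\<close> is finitely generated, so that the second
  is not vacuous.\<close>

definition bounded_packing :: "('a, 'b) monoid_scheme \<Rightarrow> 'a set \<Rightarrow> bool"
  where "bounded_packing G H \<longleftrightarrow>
    (\<exists>S. finite_generating_set G S) \<and>
    (\<forall>S. finite_generating_set G S \<longrightarrow> bounded_packing_wrt G S H)"


section \<open>Extensions of the integer lattice by an automorphism\<close>

abbreviation int_lattice :: "nat \<Rightarrow> int vec monoid"
  where "int_lattice n \<equiv> monoid_vec TYPE(int) n"

definition matrix_of :: "nat \<Rightarrow> (int vec \<Rightarrow> int vec) \<Rightarrow> int mat"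
  where "matrix_of n \<phi> = mat n n (\<lambda>(i, j). \<phi> (unit_vec n j) $ i)"

definition diagonalizable :: "'a::semiring_1 mat \<Rightarrow> bool"
  where "diagonalizable A \<longleftrightarrow> (\<exists>D. similar_mat A D \<and> diagonal_mat D)"

definition lattice_semidirect :: "nat \<Rightarrow> (int vec \<Rightarrow> int vec) \<Rightarrow> (int vec \<times> int) monoid"
  where "lattice_semidirect n \<phi> =
    semidirect_product (int_lattice n) integer_group
      (\<lambda>k. \<phi> [^]\<^bsub>AutoGroup (int_lattice n)\<^esub> k)"

lemma group_lattice_semidirect:
  assumes "\<phi> \<in> carrier (AutoGroup (int_lattice n))"
  shows "group (lattice_semidirect n \<phi>)"
proof -
  interpret L: comm_group "int_lattice n" by (rule comm_group_vec)
  interpret A: group "AutoGroup (int_lattice n)" by (rule L.AutoGroup)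
  show ?thesis
    unfolding lattice_semidirect_def
    by (rule L.group_semidirect_product)
      (use assms in \<open>auto simp: hom_def A.int_pow_mult\<close>)
qed

text \<open>With \<open>t = (0, 1)\<close>, the defining relation \<open>t a t\<^sup>-\<^sup>1 = \<phi> a\<close> holds, in the form
  \<open>t a = \<phi>(a) t\<close>.\<close>

lemma lattice_semidirect_conj:
  assumes \<phi>: "\<phi> \<in> carrier (AutoGroup (int_lattice n))" and a: "a \<in> carrier_vec n"
  shows "(0\<^sub>v n, 1) \<otimes>\<^bsub>lattice_semidirect n \<phi>\<^esub> (a, 0) =
    (\<phi> a, 0) \<otimes>\<^bsub>lattice_semidirect n \<phi>\<^esub> (0\<^sub>v n, 1)"
proof -
  interpret L: comm_group "int_lattice n" by (rule comm_group_vec)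
  interpret A: group "AutoGroup (int_lattice n)" by (rule L.AutoGroup)
  have "\<phi> a \<in> carrier_vec n"
    using assms by (auto simp: AutoGroup_def auto_def hom_def monoid_vec_simps)
  moreover have "\<phi> [^]\<^bsub>AutoGroup (int_lattice n)\<^esub> (0::int) = (\<lambda>x\<in>carrier_vec n. x)"
    by (simp add: AutoGroup_def BijGroup_def monoid_vec_simps)
  ultimately show ?thesis
    using assms
    by (simp add: lattice_semidirect_def semidirect_product_def monoid_vec_simps A.int_pow_1)
qed

lemma matrix_of_mult_vec:
  assumes \<phi>: "\<phi> \<in> carrier (AutoGroup (int_lattice n))" and a: "a \<in> carrier_vec n"
  shows "matrix_of n \<phi> *\<^sub>v a = \<phi> a"
proof -
  have cl: "\<phi> v \<in> carrier_vec n" if "v \<in> carrier_vec n" for v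
    using \<phi> that by (auto simp: AutoGroup_def auto_def hom_def monoid_vec_simps)
  have add: "\<phi> (v + w) = \<phi> v + \<phi> w" if "v \<in> carrier_vec n" "w \<in> carrier_vec n" for v w
    using \<phi> that by (auto simp: AutoGroup_def auto_def hom_def monoid_vec_simps)
  have zero: "\<phi> (0\<^sub>v n) $ i = 0" if "i < n" for i
  proof -
    have "\<phi> (0\<^sub>v n) = \<phi> (0\<^sub>v n) + \<phi> (0\<^sub>v n)"
      using add[of "0\<^sub>v n" "0\<^sub>v n"] by simp
    then have "\<phi> (0\<^sub>v n) $ i = (\<phi> (0\<^sub>v n) + \<phi> (0\<^sub>v n)) $ i" by simp
    then show ?thesis using cl[of "0\<^sub>v n"] that by simp
  qed
  have smult: "\<phi> (c \<cdot>\<^sub>v v) $ i = c * \<phi> v $ i" if v: "v \<in> carrier_vec n" and i: "i < n" for c v i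
  proof (induction c rule: int_induct[where k = 0])
    case base
    have "0 \<cdot>\<^sub>v v = 0\<^sub>v n" using v by auto
    then show ?case using zero i by simp
  next
    case (step1 c)
    have "(c + 1) \<cdot>\<^sub>v v = c \<cdot>\<^sub>v v + v" using v by (auto simp: algebra_simps)
    then show ?case using step1 add[of "c \<cdot>\<^sub>v v" v] v i cl[OF v] by (simp add: algebra_simps)
  next
    case (step2 c)
    have "c \<cdot>\<^sub>v v = (c - 1) \<cdot>\<^sub>v v + v" using v by (auto simp: algebra_simps)
    then have "\<phi> (c \<cdot>\<^sub>v v) = \<phi> ((c - 1) \<cdot>\<^sub>v v) + \<phi> v"
      using add[of "(c - 1) \<cdot>\<^sub>v v" v] v by simp
    then have "\<phi> (c \<cdot>\<^sub>v v) $ i = \<phi> ((c - 1) \<cdot>\<^sub>v v) $ i + \<phi> v $ i"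
      using v i cl[OF v] by simp
    then show ?case using step2 by (simp add: algebra_simps)
  qed
  define p where "p m = vec n (\<lambda>i. if i < m then a $ i else 0)" for m
  have p: "p m \<in> carrier_vec n" for m by (simp add: p_def)
  have sum: "\<phi> (p m) $ i = (\<Sum>j<m. \<phi> (unit_vec n j) $ i * a $ j)"
    if "m \<le> n" and i: "i < n" for m i
    using that(1)
  proof (induction m)
    case 0
    have "p 0 = 0\<^sub>v n" by (auto simp: p_def)
    then show ?case using zero i by simp
  next
    case (Suc m)
    have "p (Suc m) = p m + a $ m \<cdot>\<^sub>v unit_vec n m" 
      by (intro eq_vecI) (use Suc.prems in \<open>auto simp: p_def unit_vec_def less_Suc_eq\<close>)
    then have "\<phi> (p (Suc m)) $ i = \<phi> (p m) $ i + \<phi> (a $ m \<cdot>\<^sub>v unit_vec n m) $ i"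
      using add[OF p, of "a $ m \<cdot>\<^sub>v unit_vec n m"] cl[of "a $ m \<cdot>\<^sub>v unit_vec n m"] i by simp
    then show ?case using Suc smult[of "unit_vec n m" i "a $ m"] i by (simp add: mult.commute)
  qed
  have "p n = a" using a by (auto simp: p_def)
  then show ?thesis
    using sum[of n] cl[OF a] a
    by (auto simp: matrix_of_def scalar_prod_def lessThan_atLeast0)
qed

end

theory Submission
  imports Defs "HOL-Library.Function_Algebras"
begin

text \<open>
  Write \<open>P\<close> for the extension, \<open>\<pi>\<close> for its projection onto the integers, and \<open>K\<close> for the
  intersection of \<open>H\<close> with the lattice \<open>\<int>\<^sup>n\<close>, the kernel of \<open>\<pi>\<close>. Two cosets at distance less than \<open>r\<close>
  have representatives that differ by an element of a finite ball. Hence a family of pairwise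
  close cosets has representatives on which \<open>\<pi>\<close> takes boundedly many values, and representatives
  with the same value of \<open>\<pi>\<close> differ, modulo \<open>K\<close>, by an element \<open>h b h\<^sup>-\<^sup>1\<close> with \<open>h \<in> H\<close> and \<open>b\<close> in a
  finite subset of the lattice (\<open>near_cosets_bounded_if_kernel_bounded\<close>). Here \<open>h b h\<^sup>-\<^sup>1\<close> is
  \<open>\<phi>\<^sup>p b\<close> with \<open>p = \<pi> h\<close>, and \<open>\<pi>\<close> maps \<open>H\<close> onto \<open>m\<int>\<close> for some \<open>m\<close>. So the claim becomes: a set of
  lattice points that are distinct modulo \<open>K\<close>, with all differences in finitely many orbits of
  \<open>\<psi> = \<phi>\<^sup>m\<close> modulo \<open>K\<close>, has bounded size (\<open>card_differences_in_diagonal_orbits\<close>).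

  On the real line such a statement is elementary. If all differences of elements of a finite set \<open>Y\<close> of reals
  are of the form \<open>\<mu>\<^sup>p b\<close> with \<open>b\<close> from a finite set, then each element of \<open>Y\<close> has distance
  between \<open>D/2\<close> and \<open>D\<close> to the minimum or to the maximum of \<open>Y\<close>, where \<open>D\<close> is the diameter, and
  a geometric progression has boundedly many terms in such a range, independently of \<open>D\<close>
  (\<open>card_differences_in_orbits\<close>).

  Diagonalizability reduces the general case to the line. The real span \<open>W\<close> of \<open>K\<close> is
  \<open>\<psi>\<close>-invariant, hence is the sum of its intersections with the eigenspaces of \<open>\<psi>\<close>, and so is
  the common kernel of finitely many functionals \<open>f\<close> with \<open>f \<circ> \<psi> = \<mu> f\<close> for a real \<open>\<mu>\<close>
  (\<open>separating_eigenfunctionals\<close>). Each of them takes boundedly many values by the statement on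
  the line. Points on which all of them agree differ by an element of \<open>W \<inter> \<int>\<^sup>n\<close>, in which \<open>K\<close>
  has finite index (\<open>subgroup_in_span_finite_index\<close>).
\<close>


section \<open>Sets of reals whose differences lie in finitely many geometric progressions\<close>

lemma card_le_card_image_times:
  assumes "finite A" and "\<And>y. y \<in> f ` A \<Longrightarrow> card {x \<in> A. f x = y} \<le> k"
  shows "card A \<le> card (f ` A) * k"
proof -
  have "A = (\<Union>y\<in>f ` A. {x \<in> A. f x = y})"
    by auto
  then have "card A = card (\<Union>y\<in>f ` A. {x \<in> A. f x = y})"
    by (rule arg_cong)
  also have "\<dots> \<le> (\<Sum>y\<in>f ` A. card {x \<in> A. f x = y})"
    using assms(1) by (intro card_UN_le finite_imageI)
  also have "\<dots> \<le> card (f ` A) * k"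
    using sum_bounded_above[of "f ` A" "\<lambda>y. card {x \<in> A. f x = y}" k] assms(2) by simp
  finally show ?thesis .
qed

definition orbit_annulus :: "real \<Rightarrow> real \<Rightarrow> real \<Rightarrow> real set"
  where "orbit_annulus \<mu> b D = {x. (\<exists>p::int. x = \<mu> powi p * b) \<and> D / 2 \<le> \<bar>x\<bar> \<and> \<bar>x\<bar> \<le> D}"

text \<open>  Multiplying by a sufficiently high power of \<open>\<mu>\<close> more than doubles absolute values, so the
  exponents of the elements of the annulus lie in a window of fixed length. The bound must not
  depend on \<open>D\<close>, which will be the unknown diameter of a set.\<close>

lemma card_orbit_annulus_expanding:
  assumes \<mu>: "\<bar>\<mu>\<bar> > 1"
  shows "\<exists>M. \<forall>D>0. finite (orbit_annulus \<mu> b D) \<and> card (orbit_annulus \<mu> b D) \<le> M"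
proof -
  have "\<mu> \<noteq> 0"
    using \<mu> by auto
  obtain q where q: "\<bar>\<mu>\<bar> ^ q > 2"
    using \<mu> real_arch_pow by blast
  have "finite (orbit_annulus \<mu> b D) \<and> card (orbit_annulus \<mu> b D) \<le> 2 * q + 1" if "D > 0" for D
  proof (cases "orbit_annulus \<mu> b D = {}")
    case False
    then obtain p0 where p0: "D / 2 \<le> \<bar>\<mu> powi p0 * b\<bar>" "\<bar>\<mu> powi p0 * b\<bar> \<le> D"
      by (auto simp: orbit_annulus_def)
    have gap: "s \<le> p + int q"
      if "D / 2 \<le> \<bar>\<mu> powi p * b\<bar>" "\<bar>\<mu> powi s * b\<bar> \<le> D" for p s :: int
    proof (rule ccontr)
      assume "\<not> s \<le> p + int q"
      then have "\<bar>\<mu>\<bar> powi (int q + p) \<le> \<bar>\<mu>\<bar> powi s"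
        using \<mu> by (intro power_int_increasing) auto
      then have le: "\<bar>\<mu>\<bar> ^ q * \<bar>\<mu> powi p\<bar> \<le> \<bar>\<mu> powi s\<bar>"
        using \<open>\<mu> \<noteq> 0\<close> power_int_add[of "\<bar>\<mu>\<bar>" "int q" p] by (simp add: power_int_abs)
      have "\<bar>\<mu>\<bar> ^ q * \<bar>\<mu> powi p * b\<bar> \<le> \<bar>\<mu> powi s * b\<bar>"
        using mult_right_mono[OF le, of "\<bar>b\<bar>"] by (simp add: abs_mult mult.assoc)
      moreover have "\<bar>\<mu>\<bar> ^ q * (D / 2) \<le> \<bar>\<mu>\<bar> ^ q * \<bar>\<mu> powi p * b\<bar>"
        using that(1) by (intro mult_left_mono) auto
      moreover have "\<bar>\<mu>\<bar> ^ q * (D / 2) > 2 * (D / 2)"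
        using q \<open>D > 0\<close> by (intro mult_strict_right_mono) auto
      ultimately show False using that(2) by simp
    qed
    have "orbit_annulus \<mu> b D \<subseteq> (\<lambda>p. \<mu> powi p * b) ` {p0 - int q..p0 + int q}"
    proof
      fix x assume "x \<in> orbit_annulus \<mu> b D"
      then obtain p where p: "x = \<mu> powi p * b" "D / 2 \<le> \<bar>x\<bar>" "\<bar>x\<bar> \<le> D"
        by (auto simp: orbit_annulus_def)
      then have "p \<le> p0 + int q" "p0 \<le> p + int q"
        using gap[of p0 p] gap[of p p0] p0 by auto
      then show "x \<in> (\<lambda>p. \<mu> powi p * b) ` {p0 - int q..p0 + int q}"
        using p(1) by (intro image_eqI[of _ _ p]) auto
    qed
    then have "finite (orbit_annulus \<mu> b D)"
      and "card (orbit_annulus \<mu> b D) \<le> card ((\<lambda>p. \<mu> powi p * b) ` {p0 - int q..p0 + int q})"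
      by (auto intro: finite_subset card_mono)
    moreover have "card ((\<lambda>p. \<mu> powi p * b) ` {p0 - int q..p0 + int q}) \<le> 2 * q + 1"
      by (rule order.trans[OF card_image_le]) auto
    ultimately show ?thesis by linarith
  qed simp
  then show ?thesis by blast
qed

text \<open>  For \<open>\<bar>\<mu>\<bar> < 1\<close> the orbit is also that of the inverse of \<open>\<mu>\<close>; for \<open>\<bar>\<mu>\<bar> = 1\<close> it has at most two elements.\<close>

lemma card_orbit_annulus:
  assumes "\<mu> \<noteq> 0"
  shows "\<exists>M. \<forall>D>0. finite (orbit_annulus \<mu> b D) \<and> card (orbit_annulus \<mu> b D) \<le> M"
proof -
  consider "\<bar>\<mu>\<bar> > 1" | "\<bar>\<mu>\<bar> = 1" | "\<bar>inverse \<mu>\<bar> > 1"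
    using assms by (force simp: one_less_inverse)
  then show ?thesis
  proof cases
    case 1
    then show ?thesis by (rule card_orbit_annulus_expanding)
  next
    case 2
    have "\<mu> powi p = 1 \<or> \<mu> powi p = -1" for p
      using 2 power_int_abs[of \<mu> p] by (auto simp: abs_if split: if_splits)
    then have "\<mu> powi p * b \<in> {b, - b}" for p
      by (metis insertCI mult_1 mult_minus_left)
    then have *: "orbit_annulus \<mu> b D \<subseteq> {b, - b}" for D
      unfolding orbit_annulus_def by blast
    have "finite (orbit_annulus \<mu> b D) \<and> card (orbit_annulus \<mu> b D) \<le> card {b, - b}" for D
      by (intro conjI card_mono * finite_subset[OF *]) simp_all
    then show ?thesis by blast
  next
    case 3
    have "\<mu> powi p = inverse \<mu> powi (- p)" for p
      by (simp add: power_int_minus power_int_inverse)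
    then have "(\<exists>p::int. x = \<mu> powi p * b) = (\<exists>p::int. x = inverse \<mu> powi p * b)" for x
      by (metis minus_minus)
    then have "orbit_annulus \<mu> b = orbit_annulus (inverse \<mu>) b"
      by (simp add: orbit_annulus_def fun_eq_iff)
    then show ?thesis
      using card_orbit_annulus_expanding[OF 3, of b] by simp
  qed
qed

lemma card_orbit_annuli:
  fixes \<mu> :: real and B :: "real set"
  assumes \<mu>: "\<mu> \<noteq> 0" and B: "finite B"
  shows "\<exists>M. \<forall>D>0. \<forall>X \<subseteq> (\<Union>b\<in>B. orbit_annulus \<mu> b D). finite X \<and> card X \<le> M"
proof -
  have "\<forall>b. \<exists>M. \<forall>D>0. finite (orbit_annulus \<mu> b D) \<and> card (orbit_annulus \<mu> b D) \<le> M"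
    using card_orbit_annulus[OF \<mu>] by blast
  from choice[OF this] obtain M where
    M: "\<And>b D. D > 0 \<Longrightarrow> finite (orbit_annulus \<mu> b D) \<and> card (orbit_annulus \<mu> b D) \<le> M b"
    by blast
  have "finite X \<and> card X \<le> (\<Sum>b\<in>B. M b)"
    if "D > 0" and sub: "X \<subseteq> (\<Union>b\<in>B. orbit_annulus \<mu> b D)" for D X
  proof -
    have fin: "finite (\<Union>b\<in>B. orbit_annulus \<mu> b D)"
      using M[OF \<open>D > 0\<close>] B by blast
    have "card (\<Union>b\<in>B. orbit_annulus \<mu> b D) \<le> (\<Sum>b\<in>B. card (orbit_annulus \<mu> b D))"
      using B by (rule card_UN_le)
    also have "\<dots> \<le> (\<Sum>b\<in>B. M b)"
      using M[OF \<open>D > 0\<close>] by (intro sum_mono) auto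
    finally show ?thesis
      using finite_subset[OF sub fin] card_mono[OF fin sub] by linarith
  qed
  then show ?thesis by blast
qed

text \<open>  Every element of \<open>Y\<close> has distance at least half the diameter from one of the two extreme elements,
  and at most the diameter from both. Its difference from that extreme element is a term of one of
  the progressions in an annulus, and there are boundedly many such terms.\<close>

lemma card_differences_in_orbits:
  fixes \<mu> :: real and B :: "real set"
  assumes "\<mu> \<noteq> 0" and "finite B"
  shows "\<exists>N. \<forall>Y. finite Y \<and> (\<forall>y\<in>Y. \<forall>z\<in>Y. y \<noteq> z \<longrightarrow> (\<exists>p::int. \<exists>b\<in>B. y - z = \<mu> powi p * b)) \<longrightarrow>
    card Y \<le> N"
proof -
  obtain M where M: "\<And>D X. D > 0 \<Longrightarrow> X \<subseteq> (\<Union>b\<in>B. orbit_annulus \<mu> b D) \<Longrightarrow> finite X \<and> card X \<le> M"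
    using card_orbit_annuli[OF assms] by blast
  have bound: "card Y \<le> 2 * M + 1"
    if fin: "finite Y"
      and diff: "\<forall>y\<in>Y. \<forall>z\<in>Y. y \<noteq> z \<longrightarrow> (\<exists>p::int. \<exists>b\<in>B. y - z = \<mu> powi p * b)" for Y
  proof (cases "card Y \<le> 1")
    case False
    then have "Y \<noteq> {}" by auto
    define l u where "l = Min Y" and "u = Max Y"
    have l: "l \<in> Y" and u: "u \<in> Y" and le: "\<And>y. y \<in> Y \<Longrightarrow> l \<le> y \<and> y \<le> u"
      using fin \<open>Y \<noteq> {}\<close> by (auto simp: l_def u_def)
    have "l < u"
    proof (rule ccontr)
      assume "\<not> l < u"
      then have "Y \<subseteq> {l}"
        using le by fastforce
      then have "card Y \<le> card {l}"
        by (intro card_mono) auto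
      then show False using False by simp
    qed
    define near where "near e = {x. x + e \<in> Y \<and> (u - l) / 2 \<le> \<bar>x\<bar>}" for e
    have near: "finite (near e) \<and> card (near e) \<le> M" if "e \<in> {l, u}" for e
    proof (rule M)
      show "u - l > 0" using \<open>l < u\<close> by simp
      show "near e \<subseteq> (\<Union>b\<in>B. orbit_annulus \<mu> b (u - l))"
      proof
        fix x assume x: "x \<in> near e"
        then have Y: "x + e \<in> Y" "e \<in> Y" and half: "(u - l) / 2 \<le> \<bar>x\<bar>"
          using that l u by (auto simp: near_def)
        have "\<bar>x\<bar> \<le> u - l"
          using le[OF Y(1)] that by auto
        moreover have "\<exists>p::int. \<exists>b\<in>B. x = \<mu> powi p * b"
          using diff[rule_format, OF Y] half \<open>l < u\<close> by auto
        ultimately show "x \<in> (\<Union>b\<in>B. orbit_annulus \<mu> b (u - l))"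
          using half by (auto simp: orbit_annulus_def)
      qed
    qed
    have "y \<in> (\<lambda>x. x + l) ` near l \<union> (\<lambda>x. x + u) ` near u" if "y \<in> Y" for y
    proof -
      have "y - l \<in> near l \<or> y - u \<in> near u"
        using le[OF that] that unfolding near_def mem_Collect_eq diff_add_cancel
        by (cases "(u - l) / 2 \<le> y - l") (simp_all add: abs_real_def)
      then have "y - l + l \<in> (\<lambda>x. x + l) ` near l \<or> y - u + u \<in> (\<lambda>x. x + u) ` near u"
        by blast
      then show ?thesis by simp
    qed
    then have "Y \<subseteq> (\<lambda>x. x + l) ` near l \<union> (\<lambda>x. x + u) ` near u"
      by blast
    moreover have fin: "finite (near l)" "finite (near u)" and le_M: "card (near l) \<le> M" "card (near u) \<le> M"
      using near[of l] near[of u] by simp_all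
    ultimately have "card Y \<le> card ((\<lambda>x. x + l) ` near l \<union> (\<lambda>x. x + u) ` near u)"
      by (intro card_mono finite_UnI finite_imageI)
    also have "\<dots> \<le> card ((\<lambda>x. x + l) ` near l) + card ((\<lambda>x. x + u) ` near u)"
      by (rule card_Un_le)
    also have "\<dots> \<le> card (near l) + card (near u)"
      using fin by (intro add_mono card_image_le)
    also have "\<dots> \<le> 2 * M + 1"
      using le_M by simp
    finally show ?thesis .
  qed simp
  show ?thesis
    by (intro exI[of _ "2 * M + 1"] allI impI, elim conjE, rule bound)
qed


section \<open>Separating eigenfunctionals for an invariant subspace\<close>

text \<open>
  The dimension \<open>n\<close> is a variable, so \<open>\<real>\<^sup>n\<close> is the subspace \<open>coords n\<close> of the space of all real
  sequences. A diagonal operator is then the pointwise product with a sequence \<open>\<nu>\<close>, whose first \<open>n\<close>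
  entries are the eigenvalues.
\<close>

interpretation fun_space: vector_space "\<lambda>(c::real) (f::nat \<Rightarrow> real) i. c * f i"
  by standard (auto simp: fun_eq_iff algebra_simps)

definition coords :: "nat \<Rightarrow> (nat \<Rightarrow> real) set"
  where "coords n = {f. \<forall>i\<ge>n. f i = 0}"

definition eigencomponent :: "(nat \<Rightarrow> real) \<Rightarrow> real \<Rightarrow> (nat \<Rightarrow> real) \<Rightarrow> nat \<Rightarrow> real"
  where "eigencomponent \<nu> c f = (\<lambda>i. if \<nu> i = c then f i else 0)"

lemma coords_finitely_spanned: "\<exists>T. finite T \<and> coords n \<subseteq> fun_space.span T"
proof (induction n)
  case 0
  have "coords 0 = {0}"
    by (auto simp: coords_def fun_eq_iff)
  then show ?case
    using fun_space.span_zero[of "{}"] by (intro exI[of _ "{}"]) auto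
next
  case (Suc n)
  then obtain T where T: "finite T" "coords n \<subseteq> fun_space.span T"
    by blast
  define e :: "nat \<Rightarrow> real" where "e = (\<lambda>i. if i = n then 1 else 0)"
  have "f \<in> fun_space.span (insert e T)" if "f \<in> coords (Suc n)" for f
  proof -
    have "f - (\<lambda>i. f n * e i) \<in> coords n"
      using that by (auto simp: coords_def e_def)
    then show ?thesis
      unfolding fun_space.span_breakdown_eq using T(2) by blast
  qed
  then show ?case
    using T(1) by (intro exI[of _ "insert e T"]) auto
qed

lemma eigencomponent_coords: "f \<in> coords n \<Longrightarrow> eigencomponent \<nu> c f \<in> coords n"
  by (auto simp: coords_def eigencomponent_def)

lemma sum_eigencomponents:
  assumes "f \<in> coords n"
  shows "(\<Sum>c\<in>\<nu> ` {..<n}. eigencomponent \<nu> c f) = f"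
proof
  fix i
  have sum_apply: "(\<Sum>c\<in>A. eigencomponent \<nu> c f) i = (\<Sum>c\<in>A. eigencomponent \<nu> c f i)" for A
    by (induction A rule: infinite_finite_induct) auto
  have "(\<Sum>c\<in>\<nu> ` {..<n}. eigencomponent \<nu> c f i) = (if \<nu> i \<in> \<nu> ` {..<n} then f i else 0)"
    by (simp add: eigencomponent_def)
  also have "\<dots> = f i"
    using assms by (cases "i < n") (auto simp: coords_def)
  finally show "(\<Sum>c\<in>\<nu> ` {..<n}. eigencomponent \<nu> c f) i = f i"
    by (simp add: sum_apply)
qed

text \<open>  The projection onto an eigenspace is a polynomial in the operator, by Lagrange interpolation at
  the eigenvalues, and so it preserves invariant subspaces.\<close>

lemma eigencomponent_in_invariant_subspace:
  assumes W: "fun_space.subspace W" and inv: "\<And>w. w \<in> W \<Longrightarrow> \<nu> * w \<in> W"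
    and w: "w \<in> W" "w \<in> coords n"
  shows "eigencomponent \<nu> c w \<in> W"
proof -
  define S where "S = \<nu> ` {..<n} - {c}"
  have prod: "(\<lambda>i. (\<Prod>s\<in>A. \<nu> i - s) * w i) \<in> W" if "finite A" for A
    using that
  proof (induction A)
    case empty
    then show ?case using w by simp
  next
    case (insert a A)
    define g where "g = (\<lambda>i. (\<Prod>s\<in>A. \<nu> i - s) * w i)"
    have "\<nu> * g - (\<lambda>i. a * g i) \<in> W"
      using insert.IH W inv unfolding g_def[symmetric]
      by (intro fun_space.subspace_diff fun_space.subspace_scale) auto
    moreover have "\<nu> * g - (\<lambda>i. a * g i) = (\<lambda>i. (\<Prod>s\<in>insert a A. \<nu> i - s) * w i)"
      using insert.hyps by (auto simp: g_def fun_eq_iff algebra_simps)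
    ultimately show ?case by simp
  qed
  have nz: "(\<Prod>s\<in>S. c - s) \<noteq> 0"
    by (auto simp: S_def)
  have "eigencomponent \<nu> c w i = inverse (\<Prod>s\<in>S. c - s) * ((\<Prod>s\<in>S. \<nu> i - s) * w i)" for i
  proof (cases "i < n \<and> \<nu> i \<noteq> c")
    case True
    then have "(\<Prod>s\<in>S. \<nu> i - s) = 0"
      by (auto simp: S_def)
    with True show ?thesis by (simp add: eigencomponent_def)
  next
    case False
    then show ?thesis
      using nz w(2) by (auto simp: eigencomponent_def coords_def)
  qed
  then have "eigencomponent \<nu> c w = (\<lambda>i. inverse (\<Prod>s\<in>S. c - s) * ((\<Prod>s\<in>S. \<nu> i - s) * w i))"
    by blast
  also have "\<dots> \<in> W"
    using W prod[of S] by (intro fun_space.subspace_scale) (auto simp: S_def)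
  finally show ?thesis .
qed

lemma span_mult_closed:
  assumes "\<And>l. l \<in> L \<Longrightarrow> \<nu> * l \<in> L" and "w \<in> fun_space.span L"
  shows "\<nu> * w \<in> fun_space.span L"
  using assms(2)
proof (induction rule: fun_space.span_induct_alt)
  case base
  then show ?case using fun_space.span_zero[of L] by (simp add: times_fun_def zero_fun_def)
next
  case (step c x y)
  have "\<nu> * ((\<lambda>i. c * x i) + y) = (\<lambda>i. c * (\<nu> * x) i) + \<nu> * y"
    by (auto simp: fun_eq_iff algebra_simps)
  moreover have "\<nu> * x \<in> fun_space.span L"
    using assms(1) step(1) by (blast intro: fun_space.span_base)
  ultimately show ?case
    using step by (simp only: fun_space.span_add fun_space.span_scale)
qed

text \<open>  Extend a basis \<open>C0\<close> of the span of \<open>L\<close> by a set \<open>C - C0\<close> to a basis \<open>C\<close> of the whole space. The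
  coordinates with respect to \<open>C - C0\<close> cut out the span of \<open>L\<close>, but they are not eigenfunctionals. They
  become eigenfunctionals when composed with the projections onto the eigenspaces. The compositions still vanish
  on \<open>L\<close> because these projections preserve the span of \<open>L\<close>, and they still cut out that span
  because a vector is the sum of its eigencomponents.\<close>

lemma separating_eigenfunctionals:
  assumes L: "L \<subseteq> coords n" and inv: "\<And>l. l \<in> L \<Longrightarrow> \<nu> * l \<in> L"
  obtains \<Phi> :: "((nat \<Rightarrow> real) \<Rightarrow> real) set" where "finite \<Phi>"
    and "\<And>f x y. f \<in> \<Phi> \<Longrightarrow> x \<in> coords n \<Longrightarrow> y \<in> coords n \<Longrightarrow> f (x - y) = f x - f y"
    and "\<And>f. f \<in> \<Phi> \<Longrightarrow> \<exists>\<mu>\<in>\<nu> ` {..<n}. \<forall>x\<in>coords n. f (\<nu> * x) = \<mu> * f x"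
    and "\<And>f l. f \<in> \<Phi> \<Longrightarrow> l \<in> L \<Longrightarrow> f l = 0"
    and "\<And>x. x \<in> coords n \<Longrightarrow> \<forall>f\<in>\<Phi>. f x = 0 \<Longrightarrow> x \<in> fun_space.span L"
proof -
  obtain T where T: "finite T" "coords n \<subseteq> fun_space.span T"
    using coords_finitely_spanned by blast
  obtain C0 where C0: "C0 \<subseteq> L" "fun_space.independent C0" "L \<subseteq> fun_space.span C0"
    using fun_space.maximal_independent_subset by blast
  obtain C where C: "C0 \<subseteq> C" "C \<subseteq> coords n" "fun_space.independent C" "coords n \<subseteq> fun_space.span C"
    using fun_space.maximal_independent_subset_extend[of C0 "coords n"] C0 L by blast
  have "finite C"
    using fun_space.independent_span_bound[OF T(1) C(3)] C(2) T(2) by blast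
  have span_L: "fun_space.span L = fun_space.span C0"
    using fun_space.span_mono[OF C0(1)] fun_space.span_minimal[OF C0(3) fun_space.subspace_span] by blast
  define \<Phi> where "\<Phi> = (\<lambda>(c, b) x. fun_space.representation C (eigencomponent \<nu> c x) b) `
      (\<nu> ` {..<n} \<times> (C - C0))"
  have in_span: "eigencomponent \<nu> c x \<in> fun_space.span C" if "x \<in> coords n" for c x
    using eigencomponent_coords[OF that] C(4) by blast
  show thesis
  proof (rule that)
    show "finite \<Phi>"
      using \<open>finite C\<close> by (simp add: \<Phi>_def)
    show "f (x - y) = f x - f y" if "f \<in> \<Phi>" "x \<in> coords n" "y \<in> coords n" for f x y
    proof -
      have "eigencomponent \<nu> c (x - y) = eigencomponent \<nu> c x - eigencomponent \<nu> c y" for c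
        by (auto simp: eigencomponent_def)
      then show ?thesis
        using that in_span C(3) by (auto simp: \<Phi>_def fun_space.representation_diff)
    qed
    show "\<exists>\<mu>\<in>\<nu> ` {..<n}. \<forall>x\<in>coords n. f (\<nu> * x) = \<mu> * f x" if f: "f \<in> \<Phi>" for f
    proof -
      have "eigencomponent \<nu> c (\<nu> * x) = (\<lambda>i. c * eigencomponent \<nu> c x i)" for c x
        by (auto simp: eigencomponent_def)
      then show ?thesis
        using f in_span C(3) by (auto simp: \<Phi>_def fun_space.representation_scale)
    qed
    show "f l = 0" if f: "f \<in> \<Phi>" and l: "l \<in> L" for f l
    proof -
      obtain c b where cb: "f = (\<lambda>x. fun_space.representation C (eigencomponent \<nu> c x) b)" "b \<notin> C0"
        using f by (auto simp: \<Phi>_def)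
      have "eigencomponent \<nu> c l \<in> fun_space.span C0"
        using eigencomponent_in_invariant_subspace[OF fun_space.subspace_span, of L \<nu> l n c]
          span_mult_closed[of L \<nu>] inv L l by (auto simp: span_L[symmetric] fun_space.span_base)
      then show ?thesis
        using cb fun_space.representation_extend[OF C(3) _ C(1)] fun_space.representation_ne_zero by metis
    qed
    show "x \<in> fun_space.span L" if x: "x \<in> coords n" and zero: "\<forall>f\<in>\<Phi>. f x = 0" for x
    proof -
      have "eigencomponent \<nu> c x \<in> fun_space.span C0" if c: "c \<in> \<nu> ` {..<n}" for c
      proof -
        let ?r = "fun_space.representation C (eigencomponent \<nu> c x)"
        have "?r b = 0" if "b \<in> C - C0" for b
          using zero c that by (force simp: \<Phi>_def)
        then have "b \<in> C0" if "?r b \<noteq> 0" for b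
          using that fun_space.representation_ne_zero[of C "eigencomponent \<nu> c x" b] by blast
        then have "(\<Sum>b | ?r b \<noteq> 0. (\<lambda>i. ?r b * b i)) \<in> fun_space.span C0"
          by (intro fun_space.span_sum fun_space.span_scale fun_space.span_base) auto
        then show ?thesis
          using fun_space.sum_nonzero_representation_eq[OF C(3) in_span[OF x]] by simp
      qed
      then have "(\<Sum>c\<in>\<nu> ` {..<n}. eigencomponent \<nu> c x) \<in> fun_space.span L"
        unfolding span_L by (rule fun_space.span_sum)
      then show ?thesis
        by (simp add: sum_eigencomponents[OF x])
    qed
  qed
qed

text \<open>  Rounding down the coefficients of a linear combination of \<open>S\<close> gives an element of the subgroup; what
  remains has coefficients in the unit interval.\<close>

lemma span_near_subgroup:
  assumes zero: "0 \<in> L" and add: "\<And>x y. x \<in> L \<Longrightarrow> y \<in> L \<Longrightarrow> x + y \<in> L"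
    and neg: "\<And>x. x \<in> L \<Longrightarrow> - x \<in> L"
    and "finite S" "S \<subseteq> L" "y \<in> fun_space.span S"
  shows "\<exists>l\<in>L. \<forall>i. \<bar>(y - l) i\<bar> \<le> (\<Sum>s\<in>S. \<bar>s i\<bar>)"
  using assms(4-6)
proof (induction S arbitrary: y)
  case empty
  then show ?case using zero by (intro bexI[of _ 0]) auto
next
  case (insert a S)
  then obtain c where c: "y - (\<lambda>i. c * a i) \<in> fun_space.span S"
    by (auto simp: fun_space.span_breakdown_eq)
  with insert obtain l where l: "l \<in> L" "\<And>i. \<bar>(y - (\<lambda>i. c * a i) - l) i\<bar> \<le> (\<Sum>s\<in>S. \<bar>s i\<bar>)"
    by blast
  have mult: "(\<lambda>i. of_int k * a i) \<in> L" for k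
  proof (induction k rule: int_induct[where k = 0])
    case base
    then show ?case using zero by (simp add: zero_fun_def)
  next
    case (step1 k)
    have "(\<lambda>i. of_int (k + 1) * a i) = (\<lambda>i. of_int k * a i) + a"
      by (auto simp: algebra_simps)
    then show ?case using step1 add insert.prems by auto
  next
    case (step2 k)
    have "(\<lambda>i. of_int (k - 1) * a i) = (\<lambda>i. of_int k * a i) + - a"
      by (auto simp: algebra_simps)
    then show ?case using add[OF step2(2) neg[of a]] insert.prems by simp
  qed
  have "\<bar>(y - (l + (\<lambda>i. of_int \<lfloor>c\<rfloor> * a i))) i\<bar> \<le> (\<Sum>s\<in>insert a S. \<bar>s i\<bar>)" for i
  proof -
    have "(y - (l + (\<lambda>i. of_int \<lfloor>c\<rfloor> * a i))) i = (y - (\<lambda>i. c * a i) - l) i + frac c * a i"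
      by (simp add: frac_def algebra_simps)
    moreover have "\<bar>frac c * a i\<bar> \<le> \<bar>a i\<bar>"
      using frac_lt_1[of c] by (simp add: abs_mult mult_left_le_one_le)
    ultimately show ?thesis
      using l(2)[of i] insert.hyps by simp
  qed
  then show ?case
    using add[OF l(1) mult] by blast
qed


section \<open>Differences in finitely many orbits of a diagonal operator\<close>

text \<open>  Negative exponents need \<open>\<mu> \<noteq> 0\<close> and nonzero eigenvalues, so that the relation between \<open>f (\<nu> * x)\<close> and \<open>f x\<close> can be inverted.\<close>

lemma eigenfunctional_powi:
  fixes f :: "(nat \<Rightarrow> real) \<Rightarrow> real"
  assumes \<nu>: "\<And>i. i < n \<Longrightarrow> \<nu> i \<noteq> 0" and "\<mu> \<noteq> 0"
    and f: "\<And>x. x \<in> coords n \<Longrightarrow> f (\<nu> * x) = \<mu> * f x" and b: "b \<in> coords n"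
  shows "f (\<lambda>i. \<nu> i powi p * b i) = \<mu> powi p * f b"
proof -
  have coords: "(\<lambda>i. \<nu> i powi p * b i) \<in> coords n" for p
    using b by (simp add: coords_def)
  have step: "\<nu> * (\<lambda>i. \<nu> i powi p * b i) = (\<lambda>i. \<nu> i powi (p + 1) * b i)" for p
  proof
    fix i
    show "(\<nu> * (\<lambda>i. \<nu> i powi p * b i)) i = \<nu> i powi (p + 1) * b i"
    proof (cases "i < n")
      case True
      then show ?thesis by (simp add: \<nu> power_int_add_1 mult_ac)
    next
      case False
      then show ?thesis using b by (simp add: coords_def)
    qed
  qed
  have f_step: "f (\<lambda>i. \<nu> i powi (p + 1) * b i) = \<mu> * f (\<lambda>i. \<nu> i powi p * b i)" for p
    using f[OF coords[of p]] by (simp only: step)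
  show ?thesis
  proof (induction p rule: int_induct[where k = 0])
    case base
    then show ?case by simp
  next
    case (step1 p)
    then show ?case
      using f_step[of p] \<open>\<mu> \<noteq> 0\<close> by (simp add: power_int_add_1)
  next
    case (step2 p)
    have "\<mu> * f (\<lambda>i. \<nu> i powi (p - 1) * b i) = \<mu> powi (p - 1 + 1) * f b"
      using f_step[of "p - 1"] step2 by simp
    also have "\<dots> = \<mu> * (\<mu> powi (p - 1) * f b)"
      using \<open>\<mu> \<noteq> 0\<close> by (subst power_int_add_1) auto
    finally show ?case
      using \<open>\<mu> \<noteq> 0\<close> by simp
  qed
qed

text \<open>  For discrete \<open>\<Lambda>\<close>, the group \<open>L\<close> has finite index in the set of points of \<open>\<Lambda>\<close> in its real span: such a
  point can be moved by \<open>L\<close> into a bounded region, which contains only finitely many points of \<open>\<Lambda>\<close>.\<close>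

lemma subgroup_in_span_finite_index:
  assumes \<Lambda>: "\<Lambda> \<subseteq> coords n" and \<Lambda>_diff: "\<And>x y. x \<in> \<Lambda> \<Longrightarrow> y \<in> \<Lambda> \<Longrightarrow> x - y \<in> \<Lambda>"
    and discrete: "\<And>R. finite {x \<in> \<Lambda>. \<forall>i<n. \<bar>x i\<bar> \<le> R}"
    and L: "L \<subseteq> \<Lambda>" "0 \<in> L" "\<And>x y. x \<in> L \<Longrightarrow> y \<in> L \<Longrightarrow> x + y \<in> L" "\<And>x. x \<in> L \<Longrightarrow> - x \<in> L"
  obtains F where "finite F" "\<forall>x\<in>\<Lambda> \<inter> fun_space.span L. \<exists>l\<in>L. x - l \<in> F"
proof -
  obtain T where T: "finite T" "coords n \<subseteq> fun_space.span T"
    using coords_finitely_spanned by blast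
  obtain S where S: "S \<subseteq> L" "fun_space.independent S" "L \<subseteq> fun_space.span S"
    using fun_space.maximal_independent_subset by blast
  have "finite S"
    using fun_space.independent_span_bound[OF T(1) S(2)] S(1) L(1) \<Lambda> T(2) by blast
  define R where "R = (\<Sum>i<n. \<Sum>s\<in>S. \<bar>s i\<bar>)"
  show thesis
  proof (rule that)
    show "finite {x \<in> \<Lambda>. \<forall>i<n. \<bar>x i\<bar> \<le> R}"
      by (rule discrete)
    show "\<forall>x\<in>\<Lambda> \<inter> fun_space.span L. \<exists>l\<in>L. x - l \<in> {x \<in> \<Lambda>. \<forall>i<n. \<bar>x i\<bar> \<le> R}"
    proof
      fix x assume "x \<in> \<Lambda> \<inter> fun_space.span L"
      then have x: "x \<in> \<Lambda>" "x \<in> fun_space.span L"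
        by auto
      have "x \<in> fun_space.span S"
        using x(2) fun_space.span_minimal[OF S(3) fun_space.subspace_span] by blast
      then obtain l where l: "l \<in> L" "\<And>i. \<bar>(x - l) i\<bar> \<le> (\<Sum>s\<in>S. \<bar>s i\<bar>)"
        using span_near_subgroup[OF L(2-4) \<open>finite S\<close> S(1)] by blast
      have "(\<Sum>s\<in>S. \<bar>s i\<bar>) \<le> R" if "i < n" for i
        unfolding R_def using that by (intro member_le_sum sum_nonneg) auto
      then have "\<bar>(x - l) i\<bar> \<le> R" if "i < n" for i
        using l(2) that order.trans by blast
      then show "\<exists>l\<in>L. x - l \<in> {x \<in> \<Lambda>. \<forall>i<n. \<bar>x i\<bar> \<le> R}"
        using l(1) \<Lambda>_diff[OF x(1)] L(1) by blast
    qed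
  qed
qed

definition orbits_mod :: "(nat \<Rightarrow> real) \<Rightarrow> (nat \<Rightarrow> real) set \<Rightarrow> (nat \<Rightarrow> real) set \<Rightarrow> (nat \<Rightarrow> real) set"
  where "orbits_mod \<nu> L B = {(\<lambda>i. \<nu> i powi p * b i) + l | (p::int) b l. b \<in> B \<and> l \<in> L}"

text \<open>
  Each separating eigenfunctional maps \<open>Y\<close> to a set of reals whose differences lie in finitely many
  geometric progressions, the contribution of \<open>L\<close> being zero; so it takes boundedly many values on
  \<open>Y\<close>. Two points on which all functionals agree differ by an element of \<open>\<Lambda>\<close> in the span of \<open>L\<close>,
  and \<open>L\<close> has finite index there, so there are boundedly many such points that are distinct modulo \<open>L\<close>.
\<close>

proposition card_differences_in_diagonal_orbits:
  assumes \<nu>: "\<And>i. i < n \<Longrightarrow> \<nu> i \<noteq> 0"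
    and \<Lambda>: "\<Lambda> \<subseteq> coords n" and \<Lambda>_diff: "\<And>x y. x \<in> \<Lambda> \<Longrightarrow> y \<in> \<Lambda> \<Longrightarrow> x - y \<in> \<Lambda>"
    and discrete: "\<And>R. finite {x \<in> \<Lambda>. \<forall>i<n. \<bar>x i\<bar> \<le> R}"
    and L: "L \<subseteq> \<Lambda>" "0 \<in> L" "\<And>x y. x \<in> L \<Longrightarrow> y \<in> L \<Longrightarrow> x + y \<in> L" "\<And>x. x \<in> L \<Longrightarrow> - x \<in> L"
    and inv: "\<And>l. l \<in> L \<Longrightarrow> \<nu> * l \<in> L"
    and B: "finite B" "B \<subseteq> coords n"
  obtains N where "\<And>Y. finite Y \<Longrightarrow> Y \<subseteq> \<Lambda> \<Longrightarrow>
    (\<And>y z. y \<in> Y \<Longrightarrow> z \<in> Y \<Longrightarrow> y \<noteq> z \<Longrightarrow> y - z \<in> orbits_mod \<nu> L B - L) \<Longrightarrow> card Y \<le> N"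
proof -
  obtain \<Phi> where \<Phi>: "finite \<Phi>"
    and \<Phi>_diff: "\<And>f x y. f \<in> \<Phi> \<Longrightarrow> x \<in> coords n \<Longrightarrow> y \<in> coords n \<Longrightarrow> f (x - y) = f x - f y"
    and \<Phi>_eigen: "\<And>f. f \<in> \<Phi> \<Longrightarrow> \<exists>\<mu>\<in>\<nu> ` {..<n}. \<forall>x\<in>coords n. f (\<nu> * x) = \<mu> * f x"
    and \<Phi>_L: "\<And>f l. f \<in> \<Phi> \<Longrightarrow> l \<in> L \<Longrightarrow> f l = 0"
    and \<Phi>_span: "\<And>x. x \<in> coords n \<Longrightarrow> \<forall>f\<in>\<Phi>. f x = 0 \<Longrightarrow> x \<in> fun_space.span L"
  proof (rule separating_eigenfunctionals[OF order.trans[OF L(1) \<Lambda>] inv], goal_cases)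
    case (2 \<Phi>)
    show ?case
      by (rule 2(1)[of \<Phi>]) (rule 2(2-6); assumption)+
  qed
  obtain F where F: "finite F" "\<forall>x\<in>\<Lambda> \<inter> fun_space.span L. \<exists>l\<in>L. x - l \<in> F"
    by (rule subgroup_in_span_finite_index[OF \<Lambda> \<Lambda>_diff discrete L])
  define admissible where "admissible Y \<longleftrightarrow> finite Y \<and> Y \<subseteq> \<Lambda> \<and>
    (\<forall>y\<in>Y. \<forall>z\<in>Y. y \<noteq> z \<longrightarrow> y - z \<in> orbits_mod \<nu> L B - L)" for Y
  have "\<forall>f\<in>\<Phi>. \<exists>N. \<forall>Y. admissible Y \<longrightarrow> card (f ` Y) \<le> N"
  proof
    fix f assume f: "f \<in> \<Phi>"
    obtain \<mu> where \<mu>: "\<mu> \<in> \<nu> ` {..<n}" "\<And>x. x \<in> coords n \<Longrightarrow> f (\<nu> * x) = \<mu> * f x"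
      using \<Phi>_eigen[OF f] by blast
    then have "\<mu> \<noteq> 0" using \<nu> by auto
    have orbit_value: "\<exists>p::int. \<exists>b\<in>f ` B. f y - f z = \<mu> powi p * b"
      if Y: "admissible Y" and yz: "y \<in> Y" "z \<in> Y" "y \<noteq> z" for Y y z
    proof -
      obtain p :: int and b l where pbl: "y - z = (\<lambda>i. \<nu> i powi p * b i) + l" "b \<in> B" "l \<in> L"
        using Y yz unfolding admissible_def orbits_mod_def by blast
      have "y \<in> coords n" "z \<in> coords n"
        using Y yz(1,2) \<Lambda> unfolding admissible_def by blast+
      then have "f y - f z = f (y - z)"
        by (rule \<Phi>_diff[OF f, symmetric])
      also have "\<dots> = f ((\<lambda>i. \<nu> i powi p * b i) - (- l))"
        using pbl(1) by simp
      also have "\<dots> = f (\<lambda>i. \<nu> i powi p * b i) - f (- l)"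
      proof (rule \<Phi>_diff[OF f])
        show "(\<lambda>i. \<nu> i powi p * b i) \<in> coords n"
          using pbl(2) B(2) by (auto simp: coords_def)
        show "- l \<in> coords n"
          using L(1) L(4)[OF pbl(3)] \<Lambda> by blast
      qed
      also have "\<dots> = \<mu> powi p * f b"
      proof -
        have "f (\<lambda>i. \<nu> i powi p * b i) = \<mu> powi p * f b"
          using \<nu> \<open>\<mu> \<noteq> 0\<close> \<mu>(2) subsetD[OF B(2) pbl(2)] by (rule eigenfunctional_powi)
        then show ?thesis
          using \<Phi>_L[OF f L(4)[OF pbl(3)]] by simp
      qed
      finally show ?thesis
        using pbl(2) by blast
    qed
    obtain N where N: "\<forall>V. finite V \<and> (\<forall>y\<in>V. \<forall>z\<in>V. y \<noteq> z \<longrightarrow> (\<exists>p::int. \<exists>b\<in>f ` B. y - z = \<mu> powi p * b)) \<longrightarrow>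
        card V \<le> N"
      using card_differences_in_orbits[OF \<open>\<mu> \<noteq> 0\<close>, of "f ` B"] B(1) by blast
    have "card (f ` Y) \<le> N" if Y: "admissible Y" for Y
    proof (rule N[rule_format], intro conjI ballI impI)
      show "finite (f ` Y)"
        using Y by (simp add: admissible_def)
      fix v w assume "v \<in> f ` Y" "w \<in> f ` Y" "v \<noteq> w"
      then show "\<exists>p::int. \<exists>b\<in>f ` B. v - w = \<mu> powi p * b"
        using orbit_value[OF Y] by force
    qed
    then show "\<exists>N. \<forall>Y. admissible Y \<longrightarrow> card (f ` Y) \<le> N"
      by blast
  qed
  from bchoice[OF this] obtain N where N: "\<And>f Y. f \<in> \<Phi> \<Longrightarrow> admissible Y \<Longrightarrow> card (f ` Y) \<le> N f"
    by blast
  have bound: "card Y \<le> (\<Prod>f\<in>\<Phi>. N f) * card F" if Y: "admissible Y" for Y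
  proof -
    \<comment> \<open>All functionals at once; its values lie in a product of sets of bounded size.\<close>
    define G where "G y = restrict (\<lambda>f. f y) \<Phi>" for y
    have "finite Y" using Y by (simp add: admissible_def)
    have "card (G ` Y) \<le> card (PiE \<Phi> (\<lambda>f. f ` Y))"
      using \<open>finite Y\<close> \<Phi> by (intro card_mono finite_PiE) (auto simp: G_def)
    also have "\<dots> = (\<Prod>f\<in>\<Phi>. card (f ` Y))"
      using \<Phi> by (rule card_PiE)
    also have "\<dots> \<le> (\<Prod>f\<in>\<Phi>. N f)"
      using N Y by (intro prod_mono) auto
    finally have card_G: "card (G ` Y) \<le> (\<Prod>f\<in>\<Phi>. N f)" .
    have fibre: "card {y \<in> Y. G y = g} \<le> card F" if g: "g \<in> G ` Y" for g
    proof -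
      obtain y0 where y0: "y0 \<in> Y" "g = G y0"
        using g by blast
      have "\<exists>l\<in>L. y - y0 - l \<in> F" if y: "y \<in> Y" "G y = g" for y
      proof (rule F(2)[rule_format], rule IntI)
        have "y \<in> \<Lambda>" "y0 \<in> \<Lambda>"
          using Y y y0 by (auto simp: admissible_def)
        then show "y - y0 \<in> \<Lambda>" by (rule \<Lambda>_diff)
        have same_value: "f y = f y0" if f: "f \<in> \<Phi>" for f
        proof -
          have "G y f = G y0 f"
            using y(2) y0(2) by simp
          then show ?thesis
            using f by (simp only: G_def restrict_apply if_True)
        qed
        have coords: "y \<in> coords n" "y0 \<in> coords n" "y - y0 \<in> coords n"
          using \<open>y \<in> \<Lambda>\<close> \<open>y0 \<in> \<Lambda>\<close> \<open>y - y0 \<in> \<Lambda>\<close> \<Lambda> by blast+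
        have "f (y - y0) = 0" if f: "f \<in> \<Phi>" for f
          using \<Phi>_diff[OF f coords(1,2)] same_value[OF f] by simp
        then show "y - y0 \<in> fun_space.span L"
          using coords(3) by (intro \<Phi>_span ballI)
      qed
      then have "\<forall>y\<in>{y \<in> Y. G y = g}. \<exists>l. l \<in> L \<and> y - y0 - l \<in> F"
        by blast
      from bchoice[OF this] obtain l where
        l: "\<And>y. y \<in> Y \<Longrightarrow> G y = g \<Longrightarrow> l y \<in> L \<and> y - y0 - l y \<in> F"
        by blast
      have "inj_on (\<lambda>y. y - y0 - l y) {y \<in> Y. G y = g}"
      proof (rule inj_onI)
        fix y z assume y: "y \<in> {y \<in> Y. G y = g}" and z: "z \<in> {y \<in> Y. G y = g}"
          and eq: "y - y0 - l y = z - y0 - l z"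
        have "y - z = l y + - l z"
          using eq by (simp add: algebra_simps)
        also have "\<dots> \<in> L"
          using l y z by (intro L(3,4)) auto
        finally show "y = z"
          using Y y z unfolding admissible_def by blast
      qed
      then show ?thesis
        using l F(1) by (intro card_inj_on_le) auto
    qed
    have "card Y \<le> card (G ` Y) * card F"
      using \<open>finite Y\<close> fibre by (rule card_le_card_image_times)
    also have "\<dots> \<le> (\<Prod>f\<in>\<Phi>. N f) * card F"
      using card_G by (rule mult_right_mono) simp
    finally show ?thesis .
  qed
  show thesis
    by (rule that, rule bound) (auto simp: admissible_def)
qed


section \<open>Bounded packing via a homomorphism to the integers\<close>

context group
begin

lemma generate_word:
  assumes S: "S \<subseteq> carrier G" and g: "g \<in> generate G S"
  shows "\<exists>w. set w \<subseteq> S \<union> m_inv G ` S \<and> foldr (\<otimes>) w \<one> = g"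
proof -
  have closed: "foldr (\<otimes>) w \<one> \<in> carrier G" if "set w \<subseteq> S \<union> m_inv G ` S" for w
    using that S by (induction w) auto
  have append: "foldr (\<otimes>) (v @ w) \<one> = foldr (\<otimes>) v \<one> \<otimes> foldr (\<otimes>) w \<one>"
    if "set v \<subseteq> S \<union> m_inv G ` S" "set w \<subseteq> S \<union> m_inv G ` S" for v w
    using that(1)
  proof (induction v)
    case Nil
    show ?case using closed[OF that(2)] by simp
  next
    case (Cons a v)
    then have "a \<in> carrier G" "foldr (\<otimes>) v \<one> \<in> carrier G"
      using S closed[of v] by auto
    then show ?case
      using Cons closed[OF that(2)] by (simp add: m_assoc)
  qed
  show ?thesis
    using g
  proof (induction rule: generate.induct)
    case one
    show ?case by (rule exI[of _ "[]"]) simp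
  next
    case (incl h)
    then show ?case using S by (intro exI[of _ "[h]"]) auto
  next
    case (inv h)
    then show ?case using S by (intro exI[of _ "[inv h]"]) auto
  next
    case (eng g h)
    then obtain v w where "set v \<subseteq> S \<union> m_inv G ` S" "foldr (\<otimes>) v \<one> = g"
        "set w \<subseteq> S \<union> m_inv G ` S" "foldr (\<otimes>) w \<one> = h"
      by blast
    then show ?case
      using append[of v w] by (intro exI[of _ "v @ w"]) auto
  qed
qed

lemma finite_word_ball:
  assumes "finite_generating_set G S"
  shows "finite {g \<in> carrier G. word_length G S g < r}"
proof (rule finite_subset)
  let ?W = "{w. set w \<subseteq> S \<union> m_inv G ` S \<and> length w \<le> r}"
  have S: "finite S" "S \<subseteq> carrier G" "generate G S = carrier G"
    using assms by (auto simp: finite_generating_set_def)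
  show "finite ((\<lambda>w. foldr (\<otimes>) w \<one>) ` ?W)"
    using S(1) by (intro finite_imageI finite_lists_length_le) auto
  show "{g \<in> carrier G. word_length G S g < r} \<subseteq> (\<lambda>w. foldr (\<otimes>) w \<one>) ` ?W"
  proof
    fix g assume g: "g \<in> {g \<in> carrier G. word_length G S g < r}"
    then have "\<exists>k w. length w = k \<and> set w \<subseteq> S \<union> m_inv G ` S \<and> foldr (\<otimes>) w \<one> = g"
      using generate_word[OF S(2)] S(3) by auto
    then have "\<exists>w. length w = word_length G S g \<and> set w \<subseteq> S \<union> m_inv G ` S \<and> foldr (\<otimes>) w \<one> = g"
      unfolding word_length_def by (rule LeastI_ex)
    then obtain w where "length w = word_length G S g" "set w \<subseteq> S \<union> m_inv G ` S" "foldr (\<otimes>) w \<one> = g"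
      by blast
    then show "g \<in> (\<lambda>w. foldr (\<otimes>) w \<one>) ` ?W"
      using g by (intro image_eqI[of _ _ w]) auto
  qed
qed

definition cosets_near :: "'a set \<Rightarrow> 'a set set \<Rightarrow> bool"
  where "cosets_near F \<C> \<longleftrightarrow> (\<forall>A\<in>\<C>. \<forall>B\<in>\<C>. A \<noteq> B \<longrightarrow> (\<exists>a\<in>A. \<exists>b\<in>B. inv a \<otimes> b \<in> F))"

text \<open>
  The metric enters bounded packing only through finiteness of balls: cosets at distance less than
  \<open>r\<close> have representatives \<open>a\<close>, \<open>b\<close> with \<open>a\<^sup>-\<^sup>1 b\<close> in the ball of radius \<open>r\<close>.
\<close>

lemma bounded_packing_wrtI:
  assumes H: "subgroup H G" and S: "finite_generating_set G S"
    and bound: "\<And>F. finite F \<Longrightarrow> F \<subseteq> carrier G \<Longrightarrow>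
      \<exists>N. \<forall>\<C>. \<C> \<subseteq> lcosets H \<and> finite \<C> \<and> cosets_near F \<C> \<longrightarrow> card \<C> \<le> N"
  shows "bounded_packing_wrt G S H"
  unfolding bounded_packing_wrt_def
proof (intro allI impI)
  fix r :: real assume "r > 0"
  define F where "F = {g \<in> carrier G. word_length G S g < nat \<lceil>r\<rceil>}"
  obtain N where N: "\<And>\<C>. \<C> \<subseteq> lcosets H \<Longrightarrow> finite \<C> \<Longrightarrow> cosets_near F \<C> \<Longrightarrow> card \<C> \<le> N"
    using bound[of F] finite_word_ball[OF S] unfolding F_def by blast
  have "\<exists>A\<in>\<C>. \<exists>B\<in>\<C>. A \<noteq> B \<and> r \<le> real (word_set_dist G S A B)"
    if \<C>: "\<C> \<subseteq> lcosets H" "finite \<C>" "card \<C> = N + 1" for \<C>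
  proof (rule ccontr)
    assume far: "\<not> ?thesis"
    have "cosets_near F \<C>"
      unfolding cosets_near_def
    proof (intro ballI impI)
      fix A B assume AB: "A \<in> \<C>" "B \<in> \<C>" "A \<noteq> B"
      then have cosets: "A \<in> lcosets H" "B \<in> lcosets H"
        using \<C> by auto
      then have sub: "A \<subseteq> carrier G" "B \<subseteq> carrier G"
        using subgroup.lcosets_carrier[OF H] is_group by blast+
      obtain a b where "a \<in> A" "b \<in> B"
        using cosets lcos_self[OF _ H] unfolding LCOSETS_def by blast
      then have "{word_dist G S a b | a b. a \<in> A \<and> b \<in> B} \<noteq> {}"
        by blast
      then have "word_set_dist G S A B \<in> {word_dist G S a b | a b. a \<in> A \<and> b \<in> B}"
        unfolding word_set_dist_def by (rule Inf_nat_def1)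
      then obtain a b where ab: "a \<in> A" "b \<in> B" "word_dist G S a b = word_set_dist G S A B"
        by auto
      have "real (word_dist G S a b) < r"
        using far AB unfolding ab(3) by (meson not_le)
      then have "word_length G S (inv a \<otimes> b) < nat \<lceil>r\<rceil>"
        unfolding word_dist_def by linarith
      moreover have "inv a \<otimes> b \<in> carrier G"
        using ab sub by blast
      ultimately show "\<exists>a\<in>A. \<exists>b\<in>B. inv a \<otimes> b \<in> F"
        using ab unfolding F_def by blast
    qed
    then show False
      using N[OF \<C>(1,2)] \<C>(3) by simp
  qed
  then show "\<exists>N. \<forall>\<C>. \<C> \<subseteq> lcosets H \<and> finite \<C> \<and> card \<C> = N \<longrightarrow>
      (\<exists>A\<in>\<C>. \<exists>B\<in>\<C>. A \<noteq> B \<and> r \<le> real (word_set_dist G S A B))"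
    by (intro exI[of _ "N + 1"]) simp
qed

lemma lcoset_mem_iff:
  assumes H: "subgroup H G" and A: "A \<in> lcosets H" and x: "x \<in> A" and y: "y \<in> carrier G"
  shows "y \<in> A \<longleftrightarrow> inv x \<otimes> y \<in> H"
proof -
  have "x \<in> carrier G"
    using A x subgroup.lcosets_carrier[OF H is_group A] by blast
  moreover have "A = x <# H"
    using A x l_repr_independence[OF _ _ H] unfolding LCOSETS_def by blast
  ultimately show ?thesis
    using subgroup.lcos_module_imp[OF H is_group] subgroup.lcos_module_rev[OF H is_group] y by blast
qed

definition conjugates_mod :: "'a set \<Rightarrow> 'a set \<Rightarrow> 'a set"
  where "conjugates_mod H B = {h \<otimes> b \<otimes> inv h \<otimes> k | h b k. h \<in> H \<and> b \<in> B \<and> k \<in> H}"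

text \<open>  If \<open>x h\<close> and \<open>y h'\<close> differ by \<open>f \<in> F\<close>, then \<open>x\<^sup>-\<^sup>1 y = h f h'\<^sup>-\<^sup>1\<close>. As \<open>\<pi> x = \<pi> y\<close>, some
  element of \<open>H\<close>, namely \<open>h'\<^sup>-\<^sup>1 h\<close>, is taken by \<open>\<pi>\<close> to \<open>- \<pi> f\<close>. Choosing once and for all one such element \<open>s\<close> for each
  \<open>f\<close>, the difference becomes \<open>h (f s) h\<^sup>-\<^sup>1\<close> times an element of \<open>H\<close>, and the finitely many
  \<open>f s\<close> lie in the kernel of \<open>\<pi>\<close>.\<close>

lemma near_cosets_differ_by_conjugates:
  assumes H: "subgroup H G" and \<pi>: "\<pi> \<in> hom G integer_group"
    and F: "finite F" "F \<subseteq> carrier G"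
  obtains B where "finite B" "B \<subseteq> {g \<in> carrier G. \<pi> g = 0}"
    and "\<And>x y h h'. x \<in> carrier G \<Longrightarrow> y \<in> carrier G \<Longrightarrow> h \<in> H \<Longrightarrow> h' \<in> H \<Longrightarrow> \<pi> x = \<pi> y \<Longrightarrow>
      inv (x \<otimes> h) \<otimes> (y \<otimes> h') \<in> F \<Longrightarrow> inv x \<otimes> y \<in> conjugates_mod H B"
proof -
  interpret H: subgroup H G by (rule H)
  interpret \<pi>: group_hom G integer_group \<pi>
    using \<pi> by (intro group_hom.intro group_hom_axioms.intro is_group group_integer_group)
  define good where "good f s \<longleftrightarrow> s \<in> H \<and> \<pi> f + \<pi> s = 0" for f s
  define B where "B = (\<lambda>f. f \<otimes> (SOME s. good f s)) ` {f \<in> F. \<exists>s. good f s}"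
  have good: "good f (SOME s. good f s)" if "good f s" for f s
    using that by (rule someI)
  show thesis
  proof (rule that)
    show "finite B"
      using F(1) by (simp add: B_def)
    show "B \<subseteq> {g \<in> carrier G. \<pi> g = 0}"
    proof
      fix b assume "b \<in> B"
      then obtain f where f: "f \<in> F" "b = f \<otimes> (SOME s. good f s)" "good f (SOME s. good f s)"
        using good unfolding B_def by blast
      then have "(SOME s. good f s) \<in> carrier G" "f \<in> carrier G"
        using F(2) by (auto simp: good_def)
      then show "b \<in> {g \<in> carrier G. \<pi> g = 0}"
        using f by (simp add: good_def)
    qed
  next
    fix x y h h'
    assume xy: "x \<in> carrier G" "y \<in> carrier G" "\<pi> x = \<pi> y" and h: "h \<in> H" "h' \<in> H"
      and f: "inv (x \<otimes> h) \<otimes> (y \<otimes> h') \<in> F"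
    have hc: "h \<in> carrier G" "h' \<in> carrier G"
      using h by auto
    define f where "f = inv (x \<otimes> h) \<otimes> (y \<otimes> h')"
    have fc: "f \<in> carrier G"
      using xy hc by (simp add: f_def)
    have f_eq: "f = inv h \<otimes> (inv x \<otimes> y) \<otimes> h'"
      using xy hc by (simp add: f_def inv_mult_group m_assoc)
    have "\<pi> (inv h' \<otimes> h) = - \<pi> f"
      using xy hc by (simp add: f_eq)
    then have "good f (inv h' \<otimes> h)"
      using h by (simp add: good_def)
    define s where "s = (SOME s. good f s)"
    have s: "s \<in> H" "s \<in> carrier G"
      using good[OF \<open>good f _\<close>] by (auto simp: s_def good_def)
    have "f \<otimes> s \<in> B"
      using f \<open>good f _\<close> unfolding B_def s_def f_def[symmetric] by blast
    moreover have "h \<otimes> inv s \<otimes> inv h' \<in> H"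
      using h s by simp
    moreover have "inv x \<otimes> y = h \<otimes> (f \<otimes> s) \<otimes> inv h \<otimes> (h \<otimes> inv s \<otimes> inv h')"
    proof -
      have "h \<otimes> (f \<otimes> s) \<otimes> inv h \<otimes> (h \<otimes> inv s \<otimes> inv h') = h \<otimes> f \<otimes> inv h'"
        using hc fc s(2) by (simp add: m_assoc inv_solve_left flip: m_assoc[of "inv h" h] m_assoc[of s "inv s"])
      also have "\<dots> = inv x \<otimes> y"
        using hc xy by (simp add: f_eq m_assoc flip: m_assoc[of h "inv h"])
      finally show ?thesis by simp
    qed
    ultimately show "inv x \<otimes> y \<in> conjugates_mod H B"
      using h unfolding conjugates_mod_def by blast
  qed
qed

text \<open>
  Fix one of the cosets, \<open>g0 H\<close>. Any other one contains \<open>g0 h f\<close> for some \<open>h \<in> H\<close> and \<open>f \<in> F\<close>, hence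
  also \<open>g0 h f h\<^sup>-\<^sup>1\<close>, at which \<open>\<pi>\<close> has the value \<open>\<pi> g0 + \<pi> f\<close>. With these representatives \<open>\<pi>\<close>
  takes boundedly many values, and the hypothesis bounds the number of representatives for each of them.
  This covers subgroups inside and outside the kernel of \<open>\<pi>\<close> alike.
\<close>

proposition near_cosets_bounded_if_kernel_bounded:
  assumes H: "subgroup H G" and \<pi>: "\<pi> \<in> hom G integer_group"
    and bound: "\<And>B. finite B \<Longrightarrow> B \<subseteq> {g \<in> carrier G. \<pi> g = 0} \<Longrightarrow>
      \<exists>N. \<forall>X. finite X \<and> X \<subseteq> carrier G \<and>
        (\<forall>x\<in>X. \<forall>y\<in>X. x \<noteq> y \<longrightarrow> \<pi> x = \<pi> y \<and> inv x \<otimes> y \<in> conjugates_mod H B - H) \<longrightarrow> card X \<le> N"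
    and F: "finite F" "F \<subseteq> carrier G"
  shows "\<exists>N. \<forall>\<C>. \<C> \<subseteq> lcosets H \<and> finite \<C> \<and> cosets_near F \<C> \<longrightarrow> card \<C> \<le> N"
proof -
  interpret H: subgroup H G by (rule H)
  interpret \<pi>: group_hom G integer_group \<pi>
    using \<pi> by (intro group_hom.intro group_hom_axioms.intro is_group group_integer_group)
  obtain B where B: "finite B" "B \<subseteq> {g \<in> carrier G. \<pi> g = 0}"
    and conj: "\<And>x y h h'. x \<in> carrier G \<Longrightarrow> y \<in> carrier G \<Longrightarrow> h \<in> H \<Longrightarrow> h' \<in> H \<Longrightarrow> \<pi> x = \<pi> y \<Longrightarrow>
      inv (x \<otimes> h) \<otimes> (y \<otimes> h') \<in> F \<Longrightarrow> inv x \<otimes> y \<in> conjugates_mod H B"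
  proof (rule near_cosets_differ_by_conjugates[OF H \<pi> F], goal_cases)
    case (1 B)
    show ?case
      by (rule 1(1)[of B]) (rule 1(2-4); assumption)+
  qed
  from bound[OF B] obtain N where N: "\<forall>X. finite X \<and> X \<subseteq> carrier G \<and>
      (\<forall>x\<in>X. \<forall>y\<in>X. x \<noteq> y \<longrightarrow> \<pi> x = \<pi> y \<and> inv x \<otimes> y \<in> conjugates_mod H B - H) \<longrightarrow> card X \<le> N"
    ..
  have card_le: "card \<C> \<le> (card F + 1) * N" if \<C>: "\<C> \<subseteq> lcosets H" "finite \<C>" and near: "cosets_near F \<C>" for \<C>
  proof (cases "\<C> = {}")
    case False
    then obtain A0 where A0: "A0 \<in> \<C>" by blast
    then obtain g0 where g0: "g0 \<in> carrier G" "A0 = g0 <# H"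
      using \<C>(1) unfolding LCOSETS_def by blast
    have "g0 \<in> A0"
      using lcos_self[OF g0(1) H] g0(2) by simp
    have carrier: "A \<subseteq> carrier G" if "A \<in> \<C>" for A
      using subgroup.lcosets_carrier[OF H is_group] that \<C>(1) by blast
    let ?V = "insert (\<pi> g0) ((\<lambda>f. \<pi> g0 + \<pi> f) ` F)"
    have "\<exists>x. x \<in> A \<and> \<pi> x \<in> ?V" if A: "A \<in> \<C>" for A
    proof (cases "A = A0")
      case True
      then show ?thesis using \<open>g0 \<in> A0\<close> by blast
    next
      case False
      then obtain a b where ab: "a \<in> A0" "b \<in> A" "inv a \<otimes> b \<in> F"
        using near A0 A unfolding cosets_near_def by blast
      have ac: "a \<in> carrier G" "b \<in> carrier G"
        using ab carrier A A0 by blast+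
      define h where "h = inv a \<otimes> g0"
      have h: "h \<in> H" "h \<in> carrier G"
        using lcoset_mem_iff[OF H _ ab(1) g0(1)] \<open>g0 \<in> A0\<close> A0 \<C>(1) by (auto simp: h_def)
      have "inv b \<otimes> (b \<otimes> h) = h"
        using ac h by (simp flip: m_assoc)
      then have "b \<otimes> h \<in> A"
        using lcoset_mem_iff[OF H _ ab(2)] A \<C>(1) ac h by auto
      moreover have "\<pi> (b \<otimes> h) = \<pi> g0 + \<pi> (inv a \<otimes> b)"
        using ac h(2) g0(1) by (simp add: h_def)
      ultimately show ?thesis
        using ab(3) by blast
    qed
    then have "\<forall>A\<in>\<C>. \<exists>x. x \<in> A \<and> \<pi> x \<in> ?V" by blast
    from bchoice[OF this] obtain rep where rep: "\<And>A. A \<in> \<C> \<Longrightarrow> rep A \<in> A" "\<And>A. A \<in> \<C> \<Longrightarrow> \<pi> (rep A) \<in> ?V"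
      by blast
    have inj: "inj_on rep \<C>"
    proof (rule inj_onI, rule ccontr)
      fix A D assume AD: "A \<in> \<C>" "D \<in> \<C>" "rep A = rep D" "A \<noteq> D"
      then have "A \<inter> D = {}"
        using lcos_disjoint[OF H] \<C>(1) by blast
      then show False
        using rep(1)[OF AD(1)] rep(1)[OF AD(2)] AD(3) by auto
    qed
    have fibre: "card {x \<in> rep ` \<C>. \<pi> x = v} \<le> N" for v
    proof (rule N[THEN spec, THEN mp], intro conjI)
      show "finite {x \<in> rep ` \<C>. \<pi> x = v}"
        using \<C>(2) by simp
      show "{x \<in> rep ` \<C>. \<pi> x = v} \<subseteq> carrier G"
        using rep(1) carrier by blast
      show "\<forall>x\<in>{x \<in> rep ` \<C>. \<pi> x = v}. \<forall>y\<in>{x \<in> rep ` \<C>. \<pi> x = v}. x \<noteq> y \<longrightarrow>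
          \<pi> x = \<pi> y \<and> inv x \<otimes> y \<in> conjugates_mod H B - H"
      proof (intro ballI impI)
        fix x y assume x: "x \<in> {x \<in> rep ` \<C>. \<pi> x = v}" and y: "y \<in> {x \<in> rep ` \<C>. \<pi> x = v}"
          and "x \<noteq> y"
        then have \<pi>xy: "\<pi> x = \<pi> y" by simp
        obtain A where A: "A \<in> \<C>" "x = rep A" using x by blast
        obtain D where D: "D \<in> \<C>" "y = rep D" using y by blast
        have AD: "A \<in> \<C>" "D \<in> \<C>" "x = rep A" "y = rep D" "A \<noteq> D"
          using A D \<open>x \<noteq> y\<close> by auto
        have mem: "x \<in> A" "y \<in> D" and xy: "x \<in> carrier G" "y \<in> carrier G"
          using AD rep(1) carrier by blast+
        obtain a b where ab: "a \<in> A" "b \<in> D" "inv a \<otimes> b \<in> F"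
          using near AD unfolding cosets_near_def by blast
        have ac: "a \<in> carrier G" "b \<in> carrier G"
          using ab carrier AD by blast+
        have "inv x \<otimes> a \<in> H" "inv y \<otimes> b \<in> H"
          using lcoset_mem_iff[OF H _ mem(1) ac(1)] lcoset_mem_iff[OF H _ mem(2) ac(2)] ab AD \<C>(1) by auto
        moreover have "x \<otimes> (inv x \<otimes> a) = a" "y \<otimes> (inv y \<otimes> b) = b"
          using xy ac by (simp_all flip: m_assoc)
        ultimately have "inv x \<otimes> y \<in> conjugates_mod H B"
          using conj[OF xy, of "inv x \<otimes> a" "inv y \<otimes> b"] \<pi>xy ab(3) by simp
        moreover have "inv x \<otimes> y \<notin> H"
        proof
          assume "inv x \<otimes> y \<in> H"
          then have "y \<in> A"
            using lcoset_mem_iff[OF H _ mem(1) xy(2)] AD \<C>(1) by auto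
          then show False
            using lcos_disjoint[OF H, of A D] AD \<C>(1) mem by blast
        qed
        ultimately show "\<pi> x = \<pi> y \<and> inv x \<otimes> y \<in> conjugates_mod H B - H"
          using \<pi>xy by blast
      qed
    qed
    have "card \<C> = card (rep ` \<C>)"
      using card_image[OF inj] by simp
    also have "\<dots> \<le> card (\<pi> ` rep ` \<C>) * N"
      using \<C>(2) fibre by (intro card_le_card_image_times) auto
    also have "\<dots> \<le> (card F + 1) * N"
    proof (rule mult_right_mono)
      have "card (\<pi> ` rep ` \<C>) \<le> card ?V"
        using rep(2) F(1) by (intro card_mono) auto
      also have "\<dots> \<le> card ((\<lambda>f. \<pi> g0 + \<pi> f) ` F) + 1"
        using F(1) by (simp add: card_insert_if)
      also have "\<dots> \<le> card F + 1"
        using card_image_le[OF F(1)] by simp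
      finally show "card (\<pi> ` rep ` \<C>) \<le> card F + 1" .
    qed simp
    finally show ?thesis .
  qed simp
  show ?thesis
    by (intro exI[of _ "(card F + 1) * N"] allI impI, elim conjE, rule card_le)
qed

end


section \<open>Eigencoordinates on the integer lattice\<close>

lemma finite_bounded_int_vecs: "finite {a \<in> carrier_vec n. \<forall>i<n. \<bar>a $ i\<bar> \<le> (K::int)}"
proof (rule finite_subset)
  show "finite (vec n ` PiE {..<n} (\<lambda>_. {- K..K}))"
    by (intro finite_imageI finite_PiE) auto
  show "{a \<in> carrier_vec n. \<forall>i<n. \<bar>a $ i\<bar> \<le> K} \<subseteq> vec n ` PiE {..<n} (\<lambda>_. {- K..K})"
  proof
    fix a :: "int vec" assume a: "a \<in> {a \<in> carrier_vec n. \<forall>i<n. \<bar>a $ i\<bar> \<le> K}"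
    then have "a = vec n (restrict (\<lambda>i. a $ i) {..<n})"
      by (intro eq_vecI) auto
    moreover have "restrict (\<lambda>i. a $ i) {..<n} \<in> PiE {..<n} (\<lambda>_. {- K..K})"
      using a by (auto simp: abs_le_iff)
    ultimately show "a \<in> vec n ` PiE {..<n} (\<lambda>_. {- K..K})"
      by blast
  qed
qed

text \<open>
  When \<open>Q\<close> diagonalizes an automorphism, these are the coordinates of lattice points with respect to an eigenbasis.
\<close>

definition matrix_coords :: "nat \<Rightarrow> real mat \<Rightarrow> int vec \<Rightarrow> nat \<Rightarrow> real"
  where "matrix_coords n Q a = (\<lambda>i. if i < n then (Q *\<^sub>v map_vec real_of_int a) $ i else 0)"

lemma matrix_coords_in_coords: "matrix_coords n Q a \<in> coords n"
  by (simp add: matrix_coords_def coords_def)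

lemma matrix_coords_add:
  assumes Q: "Q \<in> carrier_mat n n" and ab: "a \<in> carrier_vec n" "b \<in> carrier_vec n"
  shows "matrix_coords n Q (a + b) = matrix_coords n Q a + matrix_coords n Q b"
proof -
  have "map_vec real_of_int (a + b) = map_vec real_of_int a + map_vec real_of_int b"
    using ab by auto
  then have "Q *\<^sub>v map_vec real_of_int (a + b) = Q *\<^sub>v map_vec real_of_int a + Q *\<^sub>v map_vec real_of_int b"
    using Q ab by (simp add: mult_add_distrib_mat_vec[of _ n n])
  then show ?thesis
    using Q by (auto simp: matrix_coords_def)
qed

lemma map_vec_of_matrix_coords:
  assumes PQ: "P \<in> carrier_mat n n" "Q \<in> carrier_mat n n" "P * Q = 1\<^sub>m n" and a: "a \<in> carrier_vec n"
  shows "map_vec real_of_int a = P *\<^sub>v vec n (matrix_coords n Q a)"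
proof -
  have "vec n (matrix_coords n Q a) = Q *\<^sub>v map_vec real_of_int a"
    using PQ(2) by (auto simp: matrix_coords_def)
  then have "P *\<^sub>v vec n (matrix_coords n Q a) = (P * Q) *\<^sub>v map_vec real_of_int a"
    using a by (simp only: assoc_mult_mat_vec[OF PQ(1,2)] map_carrier_vec)
  then show ?thesis
    unfolding PQ(3) using a by simp
qed

lemma matrix_coords_inj:
  assumes "P \<in> carrier_mat n n" "Q \<in> carrier_mat n n" "P * Q = 1\<^sub>m n"
    and ab: "a \<in> carrier_vec n" "b \<in> carrier_vec n" and eq: "matrix_coords n Q a = matrix_coords n Q b"
  shows "a = b"
proof (rule eq_vecI)
  have map: "map_vec real_of_int a = map_vec real_of_int b"
    using map_vec_of_matrix_coords[OF assms(1-3)] ab eq by simp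
  fix i assume "i < dim_vec b"
  then show "a $ i = b $ i"
    using arg_cong[OF map, of "\<lambda>v. v $ i"] ab by simp
qed (use ab in simp)

text \<open>  The inverse of \<open>Q\<close> is bounded on bounded sets, and a bounded region contains finitely many integer vectors.\<close>

lemma matrix_coords_discrete:
  assumes PQ: "P \<in> carrier_mat n n" "Q \<in> carrier_mat n n" "P * Q = 1\<^sub>m n"
  shows "finite {x \<in> matrix_coords n Q ` carrier_vec n. \<forall>i<n. \<bar>x i\<bar> \<le> R}"
proof (rule finite_subset)
  define K where "K = \<lceil>\<Sum>j<n. \<Sum>i<n. \<bar>P $$ (j, i)\<bar> * \<bar>R\<bar>\<rceil>"
  show "finite (matrix_coords n Q ` {a \<in> carrier_vec n. \<forall>i<n. \<bar>a $ i\<bar> \<le> K})"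
    by (intro finite_imageI finite_bounded_int_vecs)
  show "{x \<in> matrix_coords n Q ` carrier_vec n. \<forall>i<n. \<bar>x i\<bar> \<le> R} \<subseteq>
      matrix_coords n Q ` {a \<in> carrier_vec n. \<forall>i<n. \<bar>a $ i\<bar> \<le> K}"
  proof
    fix x assume "x \<in> {x \<in> matrix_coords n Q ` carrier_vec n. \<forall>i<n. \<bar>x i\<bar> \<le> R}"
    then obtain a where a: "a \<in> carrier_vec n" "x = matrix_coords n Q a" and bd: "\<And>i. i < n \<Longrightarrow> \<bar>x i\<bar> \<le> R"
      by blast
    have "\<bar>a $ j\<bar> \<le> K" if j: "j < n" for j
    proof -
      have "real_of_int (a $ j) = (\<Sum>i<n. P $$ (j, i) * x i)"
        using arg_cong[OF map_vec_of_matrix_coords[OF PQ a(1)], of "\<lambda>v. v $ j"] PQ(1) a j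
        by (simp add: scalar_prod_def lessThan_atLeast0)
      then have "\<bar>real_of_int (a $ j)\<bar> \<le> (\<Sum>i<n. \<bar>P $$ (j, i) * x i\<bar>)"
        by (simp only: sum_abs)
      also have "\<dots> \<le> (\<Sum>i<n. \<bar>P $$ (j, i)\<bar> * \<bar>R\<bar>)"
        using bd by (intro sum_mono) (auto simp: abs_mult intro!: mult_left_mono order.trans[OF bd])
      also have "\<dots> \<le> (\<Sum>j<n. \<Sum>i<n. \<bar>P $$ (j, i)\<bar> * \<bar>R\<bar>)"
        using j by (intro member_le_sum[of j "{..<n}" "\<lambda>j. \<Sum>i<n. \<bar>P $$ (j, i)\<bar> * \<bar>R\<bar>"] sum_nonneg) auto
      finally show ?thesis
        unfolding K_def by linarith
    qed
    then show "x \<in> matrix_coords n Q ` {a \<in> carrier_vec n. \<forall>i<n. \<bar>a $ i\<bar> \<le> K}"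
      using a by blast
  qed
qed

lemma matrix_coords_eigen:
  assumes M: "M \<in> carrier_mat n n" and wit: "similar_mat_wit (map_mat real_of_int M) D P Q"
    and D: "diagonal_mat D" and a: "a \<in> carrier_vec n"
  shows "matrix_coords n Q (M *\<^sub>v a) i = D $$ (i, i) * matrix_coords n Q a i"
proof (cases "i < n")
  case True
  have "map_mat real_of_int M \<in> carrier_mat n n"
    using M by simp
  note S = similar_mat_witD2[OF this wit]
  let ?v = "map_vec real_of_int a"
  have v: "?v \<in> carrier_vec n"
    using a by simp
  have "map_vec real_of_int (M *\<^sub>v a) = map_mat real_of_int M *\<^sub>v ?v"
    by (rule of_int_hom.mult_mat_vec_hom[OF M a])
  also have "\<dots> = (P * D) *\<^sub>v (Q *\<^sub>v ?v)"
    unfolding S(3) using S(5-7) v by (intro assoc_mult_mat_vec[of _ n n _ n]) auto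
  also have "\<dots> = P *\<^sub>v (D *\<^sub>v (Q *\<^sub>v ?v))"
    using S(5-7) v by (intro assoc_mult_mat_vec[of _ n n _ n]) auto
  finally have "Q *\<^sub>v map_vec real_of_int (M *\<^sub>v a) = Q *\<^sub>v (P *\<^sub>v (D *\<^sub>v (Q *\<^sub>v ?v)))"
    by (rule arg_cong)
  also have "\<dots> = (Q * P) *\<^sub>v (D *\<^sub>v (Q *\<^sub>v ?v))"
    using S(5-7) v by (intro assoc_mult_mat_vec[of _ n n _ n, symmetric]) auto
  also have "\<dots> = D *\<^sub>v (Q *\<^sub>v ?v)"
    unfolding S(2) using S(5-7) v by (intro one_mult_mat_vec) auto
  finally have "Q *\<^sub>v map_vec real_of_int (M *\<^sub>v a) = D *\<^sub>v (Q *\<^sub>v ?v)" .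
  moreover have "(D *\<^sub>v (Q *\<^sub>v ?v)) $ i = (\<Sum>j<n. D $$ (i, j) * (Q *\<^sub>v ?v) $ j)"
    using S True by (simp add: scalar_prod_def lessThan_atLeast0)
  moreover have "\<dots> = (\<Sum>j<n. if j = i then D $$ (i, i) * (Q *\<^sub>v ?v) $ i else 0)"
    using D S True by (intro sum.cong) (auto simp: diagonal_mat_def)
  ultimately show ?thesis
    using True by (simp add: matrix_coords_def)
qed (simp add: matrix_coords_def)

text \<open>  A coordinate that vanishes on the standard basis would be a zero row of the invertible matrix \<open>Q\<close>.
  This is used to see that no eigenvalue of a lattice automorphism is zero.\<close>

lemma matrix_coords_nontrivial:
  assumes PQ: "P \<in> carrier_mat n n" "Q \<in> carrier_mat n n" "Q * P = 1\<^sub>m n" and i: "i < n"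
  shows "\<exists>a\<in>carrier_vec n. matrix_coords n Q a i \<noteq> 0"
proof (rule ccontr)
  assume neg: "\<not> ?thesis"
  have "Q $$ (i, j) = 0" if j: "j < n" for j
  proof -
    have "map_vec real_of_int (unit_vec n j) = unit_vec n j"
      by (intro eq_vecI) (auto simp: unit_vec_def)
    then have "matrix_coords n Q (unit_vec n j) i = Q $$ (i, j)"
      using PQ(2) i j by (simp add: matrix_coords_def)
    then show ?thesis
      using neg by auto
  qed
  then have "(Q * P) $$ (i, i) = 0"
    using PQ(1,2) i by (simp add: scalar_prod_def)
  then show False
    using PQ(3) i by simp
qed


section \<open>Extensions of the lattice\<close>

lemma int_subgroup_multiples:
  fixes S :: "int set"
  assumes zero: "0 \<in> S" and diff: "\<And>x y. x \<in> S \<Longrightarrow> y \<in> S \<Longrightarrow> x - y \<in> S"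
  shows "\<exists>m\<in>S. \<forall>x\<in>S. m dvd x"
proof (cases "S \<subseteq> {0}")
  case True
  then show ?thesis using zero by auto
next
  case False
  then obtain s where s: "s \<in> S" "s \<noteq> 0" by blast
  have neg: "- x \<in> S" if "x \<in> S" for x
    using diff[OF zero that] by simp
  have "\<exists>k::nat. 0 < k \<and> int k \<in> S"
    using s neg[OF s(1)] by (intro exI[of _ "nat \<bar>s\<bar>"]) (auto simp: abs_if)
  then obtain k :: nat where k: "0 < k" "int k \<in> S" and least: "\<And>j. j < k \<Longrightarrow> \<not> (0 < j \<and> int j \<in> S)"
    using exists_least_iff[of "\<lambda>k. 0 < k \<and> int k \<in> S"] by blast
  have mult: "x - q * int k \<in> S" if "x \<in> S" for x q
  proof (induction q rule: int_induct[where k = 0])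
    case base
    then show ?case using that by simp
  next
    case (step1 q)
    then show ?case using diff[OF step1(2) k(2)] by (simp add: algebra_simps)
  next
    case (step2 q)
    then show ?case using diff[OF step2(2) neg[OF k(2)]] by (simp add: algebra_simps)
  qed
  have "int k dvd x" if x: "x \<in> S" for x
  proof -
    define j where "j = nat (x mod int k)"
    have j: "int j = x mod int k" "j < k"
      using k(1) by (auto simp: j_def nat_less_iff)
    moreover have "x mod int k \<in> S"
      using mult[OF x, of "x div int k"] by (simp add: minus_div_mult_eq_mod)
    ultimately have "j = 0"
      using least[OF j(2)] by simp
    then have "x mod int k = 0"
      using j(1) by simp
    then show ?thesis by (rule dvd_eq_mod_eq_0[THEN iffD2])
  qed
  then show ?thesis using k(2) by blast
qed

locale lattice_extension =
  fixes n :: nat and \<phi> :: "int vec \<Rightarrow> int vec"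
  assumes aut: "\<phi> \<in> carrier (AutoGroup (int_lattice n))"
begin

abbreviation P :: "(int vec \<times> int) monoid"
  where "P \<equiv> lattice_semidirect n \<phi>"

definition act :: "int \<Rightarrow> int vec \<Rightarrow> int vec"
  where "act p = \<phi> [^]\<^bsub>AutoGroup (int_lattice n)\<^esub> p"

sublocale L: comm_group "int_lattice n"
  by (rule comm_group_vec)

sublocale A: group "AutoGroup (int_lattice n)"
  by (rule L.AutoGroup)

sublocale P: group P
  by (rule group_lattice_semidirect[OF aut])

lemma act_aut: "act p \<in> carrier (AutoGroup (int_lattice n))"
  unfolding act_def using aut by simp

lemma act_closed: "a \<in> carrier_vec n \<Longrightarrow> act p a \<in> carrier_vec n"
  using act_aut[of p] by (auto simp: AutoGroup_def auto_def hom_def monoid_vec_simps)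

lemma act_add: "a \<in> carrier_vec n \<Longrightarrow> b \<in> carrier_vec n \<Longrightarrow> act p (a + b) = act p a + act p b"
  using act_aut[of p] by (auto simp: AutoGroup_def auto_def hom_def monoid_vec_simps)

lemma act_0: "a \<in> carrier_vec n \<Longrightarrow> act 0 a = a"
  by (simp add: act_def AutoGroup_def BijGroup_def monoid_vec_simps)

lemma act_1: "act 1 = \<phi>"
  using aut by (simp add: act_def A.int_pow_1)

lemma act_plus:
  assumes "a \<in> carrier_vec n"
  shows "act (p + q) a = act p (act q a)"
proof -
  have "act (p + q) = act p \<otimes>\<^bsub>AutoGroup (int_lattice n)\<^esub> act q"
    unfolding act_def using aut by (rule A.int_pow_mult)
  then show ?thesis
    using act_aut[of p] act_aut[of q] assms
    by (simp add: AutoGroup_def BijGroup_def auto_def compose_def monoid_vec_simps)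
qed

lemma carrier_P: "x \<in> carrier P \<longleftrightarrow> fst x \<in> carrier_vec n"
  by (cases x) (simp add: lattice_semidirect_def semidirect_product_def monoid_vec_simps)

lemma mult_P: "(a, p) \<otimes>\<^bsub>P\<^esub> (b, q) = (a + act p b, p + q)"
  by (simp add: lattice_semidirect_def semidirect_product_def monoid_vec_simps act_def)

lemma one_P: "\<one>\<^bsub>P\<^esub> = (0\<^sub>v n, 0)"
  by (simp add: lattice_semidirect_def semidirect_product_def monoid_vec_simps)

lemma inv_lattice: "a \<in> carrier_vec n \<Longrightarrow> inv\<^bsub>P\<^esub> (a, 0) = (- a, 0)"
  by (rule P.inv_equality) (simp_all add: mult_P act_0 one_P carrier_P)

lemma snd_hom: "snd \<in> hom P integer_group"
  by (rule homI) (auto simp: mult_P)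

text \<open>The lattice is abelian, so the conjugation action of an element on it depends only on the height of that element.\<close>

lemma conj_lattice:
  assumes h: "h \<in> carrier P" and b: "b \<in> carrier_vec n"
  shows "h \<otimes>\<^bsub>P\<^esub> (b, 0) \<otimes>\<^bsub>P\<^esub> inv\<^bsub>P\<^esub> h = (act (snd h) b, 0)"
proof -
  obtain c p where cp: "h = (c, p)" "c \<in> carrier_vec n"
    using h carrier_P by (cases h) auto
  have "h \<otimes>\<^bsub>P\<^esub> (b, 0) = (act p b, 0) \<otimes>\<^bsub>P\<^esub> h"
    using cp b act_closed[OF b, of p] by (simp add: mult_P act_0 comm_add_vec[of _ n])
  moreover have "(act p b, 0) \<in> carrier P" "(b, 0) \<in> carrier P"
    using b act_closed[OF b] by (simp_all add: carrier_P)
  ultimately show ?thesis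
    using h cp(1) by (simp add: P.m_assoc)
qed

text \<open>  The points \<open>act (- snd x) (fst x)\<close> bring elements of equal height down to the lattice, and turn
  the group difference of such elements into a difference of vectors.\<close>

lemma same_height_difference:
  assumes x: "x \<in> carrier P" and y: "y \<in> carrier P" and "snd x = snd y"
  obtains d where "d \<in> carrier_vec n" "inv\<^bsub>P\<^esub> x \<otimes>\<^bsub>P\<^esub> y = (d, 0)"
    "act (- snd y) (fst y) = act (- snd x) (fst x) + d"
proof -
  obtain d q where dq: "inv\<^bsub>P\<^esub> x \<otimes>\<^bsub>P\<^esub> y = (d, q)"
    by (metis surj_pair)
  have d: "d \<in> carrier_vec n"
    using P.m_closed[OF P.inv_closed[OF x] y] dq by (simp add: carrier_P)
  have "x \<otimes>\<^bsub>P\<^esub> (d, q) = y"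
    unfolding dq[symmetric] using x y by (simp flip: P.m_assoc)
  then have y_eq: "y = (fst x + act (snd x) d, snd x + q)"
    by (metis mult_P prod.collapse)
  from arg_cong[OF this, of snd] have "q = 0"
    using assms(3) by simp
  have xv: "fst x \<in> carrier_vec n"
    using x by (simp add: carrier_P)
  have "act (- snd x) (act (snd x) d) = d"
    using act_plus[OF d, of "- snd x" "snd x"] act_0[OF d] by simp
  then have "act (- snd y) (fst y) = act (- snd x) (fst x) + d"
    using y_eq \<open>q = 0\<close> act_add[OF xv act_closed[OF d]] by simp
  then show thesis
    using that d dq \<open>q = 0\<close> by blast
qed

lemma finitely_generated: "\<exists>S. finite_generating_set P S"
proof -
  define S :: "(int vec \<times> int) set" where "S = insert (0\<^sub>v n, 1) ((\<lambda>i. (unit_vec n i, 0)) ` {..<n})"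
  have S: "S \<subseteq> carrier P"
    by (auto simp: S_def carrier_P)
  interpret S: subgroup "generate P S" P
    by (rule P.generate_is_subgroup[OF S])
  have smult: "(k \<cdot>\<^sub>v unit_vec n i, 0) \<in> generate P S" if i: "i < n" for k i
  proof (induction k rule: int_induct[where k = 0])
    case base
    have "0 \<cdot>\<^sub>v unit_vec n i = (0\<^sub>v n :: int vec)" by auto
    then show ?case using S.one_closed by (simp add: one_P)
  next
    case (step1 k)
    have "(unit_vec n i, 0) \<in> generate P S"
      using i by (intro generate.incl) (auto simp: S_def)
    from S.m_closed[OF step1(2) this] show ?case
      by (simp add: mult_P act_0 add_smult_distrib_vec)
  next
    case (step2 k)
    have "(unit_vec n i, 0) \<in> generate P S"
      using i by (intro generate.incl) (auto simp: S_def)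
    from S.m_closed[OF step2(2) S.m_inv_closed[OF this]]
    have "(k \<cdot>\<^sub>v unit_vec n i + - unit_vec n i, 0) \<in> generate P S"
      by (simp add: inv_lattice mult_P act_0)
    moreover have "k \<cdot>\<^sub>v unit_vec n i + - unit_vec n i = (k - 1) \<cdot>\<^sub>v unit_vec n i"
      by (intro eq_vecI) (auto simp: algebra_simps)
    ultimately show ?case by simp
  qed
  have lattice: "(a, 0) \<in> generate P S" if a: "a \<in> carrier_vec n" for a
  proof -
    have "(vec n (\<lambda>i. if i < m then a $ i else 0), 0) \<in> generate P S" if "m \<le> n" for m
      using that
    proof (induction m)
      case 0
      have "vec n (\<lambda>i. if i < 0 then a $ i else 0) = 0\<^sub>v n" by auto
      then show ?case using S.one_closed by (simp add: one_P)
    next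
      case (Suc m)
      let ?v = "vec n (\<lambda>i. if i < m then a $ i else 0)"
      have "vec n (\<lambda>i. if i < Suc m then a $ i else 0) = ?v + a $ m \<cdot>\<^sub>v unit_vec n m"
        by (intro eq_vecI) (use Suc.prems in \<open>auto simp: unit_vec_def less_Suc_eq\<close>)
      moreover have "(?v, 0) \<otimes>\<^bsub>P\<^esub> (a $ m \<cdot>\<^sub>v unit_vec n m, 0) \<in> generate P S"
        using Suc smult[of m "a $ m"] by (intro S.m_closed) auto
      ultimately show ?case
        by (simp add: mult_P act_0)
    qed
    from this[of n] have "(vec n (\<lambda>i. if i < n then a $ i else 0), 0) \<in> generate P S"
      by simp
    moreover have "vec n (\<lambda>i. if i < n then a $ i else 0) = a"
      using a by auto
    ultimately show ?thesis by simp
  qed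
  have t: "(0\<^sub>v n, 1) \<in> generate P S"
    by (intro generate.incl) (simp add: S_def)
  have act_zero: "act p (0\<^sub>v n) = 0\<^sub>v n" for p
    using act_add[of "0\<^sub>v n" "0\<^sub>v n" p] act_closed[of "0\<^sub>v n" p]
    by (metis L.r_cancel_one' monoid_vec_simps(1,2,3) zero_carrier_vec)
  have power: "(0\<^sub>v n, p) \<in> generate P S" for p
  proof (induction p rule: int_induct[where k = 0])
    case base
    show ?case using S.one_closed by (simp add: one_P)
  next
    case (step1 p)
    from S.m_closed[OF step1(2) t] show ?case
      by (simp add: mult_P act_zero)
  next
    case (step2 p)
    have "inv\<^bsub>P\<^esub> (0\<^sub>v n, 1) = (0\<^sub>v n, -1)"
      by (rule P.inv_equality) (simp_all add: mult_P act_zero one_P carrier_P)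
    with S.m_closed[OF step2(2) S.m_inv_closed[OF t]] show ?case
      by (simp add: mult_P act_zero)
  qed
  have "(a, p) \<in> generate P S" if "a \<in> carrier_vec n" for a p
    using S.m_closed[OF lattice[OF that] power[of p]] that by (simp add: mult_P act_0)
  then have "carrier P \<subseteq> generate P S"
    by (auto simp: carrier_P)
  then have "generate P S = carrier P"
    using S.subset by blast
  moreover have "finite S"
    by (simp add: S_def)
  ultimately show ?thesis
    using S unfolding finite_generating_set_def by blast
qed

end

context lattice_extension
begin

text \<open>  In eigencoordinates, conjugation by an element of height \<open>m j\<close> multiplies by the \<open>j\<close>-th powers of \<open>\<nu> i = d i powi m\<close>,
  where \<open>m\<close> generates the group of heights of \<open>H\<close>. So the differences of the representatives lie in
  finitely many orbits of a diagonal operator modulo the image \<open>L\<close> of the intersection of \<open>H\<close> with the lattice.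
  A subgroup inside the lattice is the case \<open>m = 0\<close>, with all \<open>\<nu> i = 1\<close>.\<close>

lemma coset_representatives_bounded:
  assumes diag: "diagonalizable (map_mat real_of_int (matrix_of n \<phi>))"
    and H: "subgroup H P" and B: "finite B" "B \<subseteq> {g \<in> carrier P. snd g = 0}"
  shows "\<exists>N. \<forall>X. finite X \<and> X \<subseteq> carrier P \<and>
    (\<forall>x\<in>X. \<forall>y\<in>X. x \<noteq> y \<longrightarrow> snd x = snd y \<and> inv\<^bsub>P\<^esub> x \<otimes>\<^bsub>P\<^esub> y \<in> P.conjugates_mod H B - H) \<longrightarrow> card X \<le> N"
proof -
  interpret H: subgroup H P by (rule H)
  obtain D U Q where wit: "similar_mat_wit (map_mat real_of_int (matrix_of n \<phi>)) D U Q" and D: "diagonal_mat D"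
    using diag unfolding diagonalizable_def similar_mat_def by blast
  have M: "matrix_of n \<phi> \<in> carrier_mat n n"
    by (simp add: matrix_of_def)
  then have MR: "map_mat real_of_int (matrix_of n \<phi>) \<in> carrier_mat n n"
    by simp
  note UQ = similar_mat_witD2[OF MR wit]
  define e where "e = matrix_coords n Q"
  define d where "d i = D $$ (i, i)" for i
  have e_coords: "e a \<in> coords n" for a
    by (simp add: e_def matrix_coords_in_coords)
  have e_add: "e (a + b) = e a + e b" if "a \<in> carrier_vec n" "b \<in> carrier_vec n" for a b
    unfolding e_def using UQ(7) that by (rule matrix_coords_add)
  have e_inj: "a = b" if "a \<in> carrier_vec n" "b \<in> carrier_vec n" "e a = e b" for a b
    using matrix_coords_inj[OF UQ(6,7,1)] that unfolding e_def by blast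
  have e_zero: "e (0\<^sub>v n) = 0"
    using e_add[of "0\<^sub>v n" "0\<^sub>v n"] by simp
  have e_neg: "e (- a) = - e a" if a: "a \<in> carrier_vec n" for a
    using e_add[of "- a" a] a e_zero by (simp add: eq_neg_iff_add_eq_0)
  have e_\<phi>: "e (\<phi> a) i = d i * e a i" if "a \<in> carrier_vec n" for a i
    using matrix_coords_eigen[OF M wit D that] matrix_of_mult_vec[OF aut that] by (simp add: e_def d_def)
  have e_step: "e (act (p + 1) a) i = d i * e (act p a) i" if a: "a \<in> carrier_vec n" for a p i
    using e_\<phi>[OF act_closed[OF a], of p i] act_plus[OF a, of 1 p] by (simp add: act_1 add.commute)
  have d_nonzero: "d i \<noteq> 0" if i: "i < n" for i
  proof
    assume "d i = 0"
    obtain a where a: "a \<in> carrier_vec n" "e a i \<noteq> 0"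
      using matrix_coords_nontrivial[OF UQ(6,7,2) i] unfolding e_def by blast
    have "e (act (- 1 + 1) a) i = 0"
      unfolding e_step[OF a(1)] using \<open>d i = 0\<close> by simp
    then show False
      using a by (simp add: act_0)
  qed
  have e_act: "e (act p a) i = d i powi p * e a i" if a: "a \<in> carrier_vec n" for a p i
  proof (cases "i < n")
    case True
    show ?thesis
    proof (induction p rule: int_induct[where k = 0])
      case base
      then show ?case using a by (simp add: act_0)
    next
      case (step1 p)
      then show ?case
        using e_step[OF a, of p i] d_nonzero[OF True] by (simp add: power_int_add_1)
    next
      case (step2 p)
      have "d i * e (act (p - 1) a) i = d i powi (p - 1 + 1) * e a i"
        using e_step[OF a, of "p - 1" i] step2(2) by simp
      also have "\<dots> = d i * (d i powi (p - 1) * e a i)"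
        using d_nonzero[OF True] by (subst power_int_add_1) auto
      finally show ?case
        using d_nonzero[OF True] by simp
    qed
  next
    case False
    then show ?thesis
      using e_coords[of "act p a"] e_coords[of a] by (simp add: coords_def)
  qed
  have "\<exists>m\<in>snd ` H. \<forall>p\<in>snd ` H. m dvd p"
  proof (rule int_subgroup_multiples)
    show "0 \<in> snd ` H"
      using H.one_closed by (force simp: one_P)
    interpret \<pi>: group_hom P integer_group snd
      using snd_hom by (intro group_hom.intro group_hom_axioms.intro P.is_group group_integer_group)
    fix p q assume "p \<in> snd ` H" "q \<in> snd ` H"
    then obtain g h where gh: "g \<in> H" "h \<in> H" "p = snd g" "q = snd h"
      by blast
    have "snd (g \<otimes>\<^bsub>P\<^esub> inv\<^bsub>P\<^esub> h) = p - q"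
      using gh by simp
    then show "p - q \<in> snd ` H"
      using gh H.m_closed[OF _ H.m_inv_closed] by (metis image_eqI)
  qed
  then obtain m where m: "m \<in> snd ` H" "\<And>h. h \<in> H \<Longrightarrow> m dvd snd h"
    by blast
  define \<nu> where "\<nu> i = d i powi m" for i
  define L where "L = e ` {a \<in> carrier_vec n. (a, 0) \<in> H}"
  have L_intro: "e a \<in> L" if "a \<in> carrier_vec n" "(a, 0) \<in> H" for a
    using that by (auto simp: L_def)
  obtain N where N: "\<And>Y. finite Y \<Longrightarrow> Y \<subseteq> e ` carrier_vec n \<Longrightarrow>
      (\<And>y z. y \<in> Y \<Longrightarrow> z \<in> Y \<Longrightarrow> y \<noteq> z \<Longrightarrow> y - z \<in> orbits_mod \<nu> L ((e \<circ> fst) ` B) - L) \<Longrightarrow> card Y \<le> N"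
  proof (rule card_differences_in_diagonal_orbits[of n \<nu> "e ` carrier_vec n" L "(e \<circ> fst) ` B"])
    show "\<nu> i \<noteq> 0" if "i < n" for i
      using d_nonzero[OF that] by (simp add: \<nu>_def)
    show "e ` carrier_vec n \<subseteq> coords n"
      using e_coords by blast
    show "x - y \<in> e ` carrier_vec n" if xy: "x \<in> e ` carrier_vec n" "y \<in> e ` carrier_vec n" for x y
    proof -
      obtain a b where ab: "a \<in> carrier_vec n" "b \<in> carrier_vec n" "x = e a" "y = e b"
        using xy by blast
      then have "x - y = e (a + - b)"
        by (simp add: e_add e_neg)
      then show ?thesis
        using ab by (intro image_eqI[of _ _ "a + - b"]) auto
    qed
    show "finite {x \<in> e ` carrier_vec n. \<forall>i<n. \<bar>x i\<bar> \<le> R}" for R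
      unfolding e_def by (rule matrix_coords_discrete[OF UQ(6,7,1)])
    show "L \<subseteq> e ` carrier_vec n"
      by (auto simp: L_def)
    show "0 \<in> L"
      using L_intro[of "0\<^sub>v n"] H.one_closed by (simp add: e_zero one_P)
    show "x + y \<in> L" if x: "x \<in> L" "y \<in> L" for x y
    proof -
      obtain a b where ab: "a \<in> carrier_vec n" "b \<in> carrier_vec n" "(a, 0) \<in> H" "(b, 0) \<in> H" "x = e a" "y = e b"
        using x unfolding L_def by blast
      then have "(a + b, 0) \<in> H"
        using H.m_closed[OF ab(3,4)] by (simp add: mult_P act_0)
      then show ?thesis
        using ab L_intro[of "a + b"] by (simp add: e_add)
    qed
    show "- x \<in> L" if x: "x \<in> L" for x
    proof -
      obtain a where a: "a \<in> carrier_vec n" "(a, 0) \<in> H" "x = e a"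
        using x unfolding L_def by blast
      then have "(- a, 0) \<in> H"
        using H.m_inv_closed[OF a(2)] by (simp add: inv_lattice)
      then show ?thesis
        using a L_intro[of "- a"] by (simp add: e_neg)
    qed
    show "\<nu> * l \<in> L" if l: "l \<in> L" for l
    proof -
      obtain a where a: "a \<in> carrier_vec n" "(a, 0) \<in> H" "l = e a"
        using l unfolding L_def by blast
      obtain h where h: "h \<in> H" "m = snd h"
        using m(1) by blast
      have "(act m a, 0) \<in> H"
        using conj_lattice[of h a] a h H.m_closed[OF H.m_closed[OF h(1) a(2)] H.m_inv_closed[OF h(1)]]
        by simp
      then have "e (act m a) \<in> L"
        using a by (intro L_intro act_closed)
      moreover have "e (act m a) = \<nu> * l"
        using a by (simp add: fun_eq_iff e_act \<nu>_def)
      ultimately show ?thesis by simp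
    qed
    show "finite ((e \<circ> fst) ` B)" "(e \<circ> fst) ` B \<subseteq> coords n"
      using B(1) e_coords by auto
  qed blast
  have card_le: "card X \<le> N" if fin: "finite X" and X: "X \<subseteq> carrier P"
    and diff: "\<forall>x\<in>X. \<forall>y\<in>X. x \<noteq> y \<longrightarrow> snd x = snd y \<and> inv\<^bsub>P\<^esub> x \<otimes>\<^bsub>P\<^esub> y \<in> P.conjugates_mod H B - H" for X
  proof -
    define f where "f x = e (act (- snd x) (fst x))" for x
    have f_diff: "f y - f x \<in> orbits_mod \<nu> L ((e \<circ> fst) ` B) - L" if xy: "x \<in> X" "y \<in> X" "x \<noteq> y" for x y
    proof -
      have c: "x \<in> carrier P" "y \<in> carrier P" "snd x = snd y"
        and conj: "inv\<^bsub>P\<^esub> x \<otimes>\<^bsub>P\<^esub> y \<in> P.conjugates_mod H B" and notin: "inv\<^bsub>P\<^esub> x \<otimes>\<^bsub>P\<^esub> y \<notin> H"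
        using diff[rule_format, OF xy] xy(1,2) X by auto
      obtain u where u: "u \<in> carrier_vec n" "inv\<^bsub>P\<^esub> x \<otimes>\<^bsub>P\<^esub> y = (u, 0)"
          "act (- snd y) (fst y) = act (- snd x) (fst x) + u"
        by (rule same_height_difference[OF c])
      have "fst x \<in> carrier_vec n"
        using c(1) by (simp add: carrier_P)
      then have f_eq: "f y - f x = e u"
        unfolding f_def u(3) using u(1) by (simp add: e_add act_closed)
      have "e u \<notin> L"
      proof
        assume "e u \<in> L"
        then obtain a where "a \<in> carrier_vec n" "(a, 0) \<in> H" "e u = e a"
          unfolding L_def by blast
        then show False
          using e_inj[OF u(1)] notin u(2) by simp
      qed
      moreover have "e u \<in> orbits_mod \<nu> L ((e \<circ> fst) ` B)"
      proof -
        obtain h b k where hbk: "h \<in> H" "b \<in> B" "k \<in> H"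
            "(u, 0) = h \<otimes>\<^bsub>P\<^esub> b \<otimes>\<^bsub>P\<^esub> inv\<^bsub>P\<^esub> h \<otimes>\<^bsub>P\<^esub> k"
          using conj unfolding u(2) P.conjugates_mod_def by blast
        have b: "b = (fst b, 0)" "fst b \<in> carrier_vec n"
          using hbk(2) B(2) by (auto simp: carrier_P prod_eq_iff)
        have kc: "fst k \<in> carrier_vec n"
          using hbk(3) H.mem_carrier carrier_P by blast
        have "(u, 0) = (act (snd h) (fst b), 0) \<otimes>\<^bsub>P\<^esub> k"
          using hbk(4) conj_lattice[OF H.mem_carrier[OF hbk(1)] b(2)] b(1) by simp
        also have "\<dots> = (act (snd h) (fst b) + fst k, snd k)"
          using mult_P[of _ 0 "fst k" "snd k"] kc by (simp add: act_0)
        finally have u_eq: "u = act (snd h) (fst b) + fst k" and "snd k = 0"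
          by simp_all
        then have k: "(fst k, 0) \<in> H"
          using hbk(3) by (metis prod.collapse)
        obtain j where j: "snd h = m * j"
          using m(2)[OF hbk(1)] by (auto elim: dvdE)
        have "e (act (snd h) (fst b)) = (\<lambda>i. \<nu> i powi j * (e \<circ> fst) b i)"
          using b(2) by (auto simp: e_act \<nu>_def j power_int_mult)
        then have "e u = (\<lambda>i. \<nu> i powi j * (e \<circ> fst) b i) + e (fst k)"
          unfolding u_eq using b(2) kc by (simp add: e_add act_closed)
        moreover have "e (fst k) \<in> L"
          using L_intro[OF kc k] .
        ultimately show ?thesis
          using hbk(2) unfolding orbits_mod_def by blast
      qed
      ultimately show ?thesis
        unfolding f_eq by blast
    qed
    have "inj_on f X"
    proof (rule inj_onI, rule ccontr)
      fix x y assume xy: "x \<in> X" "y \<in> X" "f x = f y" "x \<noteq> y"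
      have "0 \<in> L"
        using L_intro[of "0\<^sub>v n"] H.one_closed by (simp add: e_zero one_P)
      then show False
        using f_diff[OF xy(1,2,4)] xy(3) by simp
    qed
    then have "card X = card (f ` X)"
      by (simp add: card_image)
    also have "\<dots> \<le> N"
    proof (rule N)
      show "finite (f ` X)" using fin by simp
      show "f ` X \<subseteq> e ` carrier_vec n"
        using X act_closed by (auto simp: f_def carrier_P subset_iff)
      show "v - w \<in> orbits_mod \<nu> L ((e \<circ> fst) ` B) - L" if "v \<in> f ` X" "w \<in> f ` X" "v \<noteq> w" for v w
        using f_diff that by blast
    qed
    finally show ?thesis .
  qed
  show ?thesis
    by (intro exI[of _ N] allI impI, elim conjE, rule card_le)
qed

end

theorem theorem3p6p4:
  fixes n :: nat and \<phi> :: "int vec \<Rightarrow> int vec" and H :: "(int vec \<times> int) set"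
  assumes "\<phi> \<in> carrier (AutoGroup (int_lattice n))"
    and "diagonalizable (map_mat real_of_int (matrix_of n \<phi>))"
    and "subgroup H (lattice_semidirect n \<phi>)"
  shows "bounded_packing (lattice_semidirect n \<phi>) H"
proof -
  interpret lattice_extension n \<phi>
    by unfold_locales (rule assms(1))
  have "bounded_packing_wrt P S H" if "finite_generating_set P S" for S
    by (rule P.bounded_packing_wrtI[OF assms(3) that],
        rule P.near_cosets_bounded_if_kernel_bounded[OF assms(3) snd_hom],
        rule coset_representatives_bounded[OF assms(2,3)])
  then show ?thesis
    using finitely_generated unfolding bounded_packing_def by blast
qed

end
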